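(* Suppose that $\phi \Delta_2 = O(\Delta_3)$. Then, for every $Y\subset [N]$ with $|Y| = O(\mu)$, we have $$\mathbb{P}( I = Y ) \le \pi^{|Y|} (1-\pi)^{N - |Y|} \, p^{-t(Y)} \exp\bigg( - \bigg( \frac{2|Y|}{\mu} - 1 \bigg) \big( \Delta_2 - \Delta_2^0 \big) + \eta(Y) \bigg),$$ where $$\eta(Y) = O\Big( \Delta_3 + \phi \cdot Q_2(Y) + Q_3(Y) + Q_4(Y) + \pi^2 N \Big).$$
   Context: Setting: $\mathcal{H}$ is an $s$-uniform hypergraph with finite vertex set $X$ and edges $E_1,\ldots,E_N$; $p\in(0,1)$; $X_p$ is the random subset of $X$ obtained by selecting each element independently with probability $p$; $A_i$ is the event $E_i\subset X_p$; $\pi=p^s$ and $\mu=\pi N$. All of these may depend on an asymptotic parameter $n\to\infty$. It is assumed that $1-\pi=\Omega(1)$ and that $\mathcal{H}$ is symmetric: for all $i,j$ there is an automorphism of $\mathcal{H}$ mapping $E_i$ to $E_j$. The random set under study is $I=\{i\in[N]: A_i \text{ holds}\}$. Write $i\sim j$ if $i\ne j$ and $E_i\cap E_j\neq\emptyset$. A $k$-cluster is a set $S\subset[N]$ with $|S|=k$ on which the relation $\sim$ induces a connected graph. $\Delta_k$ is the expected number of $k$-clusters $S$ with $S\subset I$; in particular $\Delta_2=\frac12\sum_{i\sim j}\mathbb{P}(A_i\cap A_j)$ (sum over ordered pairs). Also $$\Delta_2^0=\frac12\sum_{i\sim j}\mathbb{P}(A_i)\mathbb{P}(A_j),\qquad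 \phi=\max_{i\ne j}\mathbb{P}(A_i\mid A_j).$$ For $Y\subset[N]$ let $R(Y)=\bigcup_{j\in Y}E_j$, $t(Y)=s|Y|-|R(Y)|$, and $$Q_2(Y)=\frac12\sum_{i\sim j}\mathbf{1}[i,j\in Y],\qquad Q_3(Y)=\sum_{(i,j,k)}\mathbf{1}[i,j\in Y]\,\mathbb{P}(A_k\mid A_i),$$ where the second sum is over ordered triples of distinct indices such that $\{i,j,k\}$ is a 3-cluster, and $$Q_4(Y)=\sum_{\substack{i\sim i'\sim j'\sim j\\ i'\not\sim j,\ i\not\sim j'}}\mathbf{1}[i,j\in Y]\,\mathbb{P}(A_{i'}\cap A_{j'}\mid A_i\cap A_j),$$ the sum being over 4-tuples $(i,i',j',j)$ of distinct indices with the given intersection structure. The implicit constant in the conclusion depends only on the implicit constants in the hypotheses. *)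

theory Defs
  imports "HOL-Probability.Probability"
begin

text \<open>
  A hypergraph on the vertex set \<open>X\<close> is given by an enumeration \<open>E 1, ..., E N\<close> of its edges
  without repetitions. The values of \<open>E\<close> outside \<open>{1..N}\<close> are irrelevant.
\<close>

definition uniform_hypergraph :: "'a set \<Rightarrow> nat \<Rightarrow> (nat \<Rightarrow> 'a set) \<Rightarrow> nat \<Rightarrow> bool" where
  "uniform_hypergraph X N E s \<longleftrightarrow>
     finite X \<and> inj_on E {1..N} \<and> (\<forall>i\<in>{1..N}. E i \<subseteq> X \<and> card (E i) = s)"

definition hypergraph_automorphism :: "'a set \<Rightarrow> nat \<Rightarrow> (nat \<Rightarrow> 'a set) \<Rightarrow> ('a \<Rightarrow> 'a) \<Rightarrow> bool" where
  "hypergraph_automorphism X N E \<sigma> \<longleftrightarrow>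
     bij_betw \<sigma> X X \<and> (\<lambda>e. \<sigma> ` e) ` (E ` {1..N}) = E ` {1..N}"

definition symmetric_hypergraph :: "'a set \<Rightarrow> nat \<Rightarrow> (nat \<Rightarrow> 'a set) \<Rightarrow> bool" where
  "symmetric_hypergraph X N E \<longleftrightarrow>
     (\<forall>i\<in>{1..N}. \<forall>j\<in>{1..N}. \<exists>\<sigma>. hypergraph_automorphism X N E \<sigma> \<and> \<sigma> ` E i = E j)"

definition random_subset :: "'a set \<Rightarrow> real \<Rightarrow> 'a set pmf" where
  "random_subset X p = map_pmf (\<lambda>b. {x\<in>X. b x}) (Pi_pmf X False (\<lambda>_. bernoulli_pmf p))"

text \<open>The random index set \<open>I\<close>, as a function of the outcome \<open>W\<close> of the random subset.\<close>

definition contained_edges :: "nat \<Rightarrow> (nat \<Rightarrow> 'a set) \<Rightarrow> 'a set \<Rightarrow> nat set" where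
  "contained_edges N E W = {i\<in>{1..N}. E i \<subseteq> W}"

definition adj :: "(nat \<Rightarrow> 'a set) \<Rightarrow> nat \<Rightarrow> nat \<Rightarrow> bool" where
  "adj E i j \<longleftrightarrow> i \<noteq> j \<and> E i \<inter> E j \<noteq> {}"

definition cluster :: "nat \<Rightarrow> (nat \<Rightarrow> 'a set) \<Rightarrow> nat \<Rightarrow> nat set \<Rightarrow> bool" where
  "cluster N E k S \<longleftrightarrow> S \<subseteq> {1..N} \<and> card S = k \<and>
     (\<forall>i\<in>S. \<forall>j\<in>S. (i, j) \<in> {(a, b). a \<in> S \<and> b \<in> S \<and> adj E a b}\<^sup>*)"

definition Delta :: "'a set \<Rightarrow> nat \<Rightarrow> (nat \<Rightarrow> 'a set) \<Rightarrow> real \<Rightarrow> nat \<Rightarrow> real" where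
  "Delta X N E p k = measure_pmf.expectation (random_subset X p)
     (\<lambda>W. real (card {S. cluster N E k S \<and> S \<subseteq> contained_edges N E W}))"

definition Delta2_0 :: "'a set \<Rightarrow> nat \<Rightarrow> (nat \<Rightarrow> 'a set) \<Rightarrow> real \<Rightarrow> real" where
  "Delta2_0 X N E p = 1/2 * (\<Sum>(i, j) \<in> {(i, j). i \<in> {1..N} \<and> j \<in> {1..N} \<and> adj E i j}.
     \<P>(W in random_subset X p. E i \<subseteq> W) * \<P>(W in random_subset X p. E j \<subseteq> W))"

text \<open>
  The additional element \<open>0\<close> only fixes the value of the maximum when \<open>N \<le> 1\<close>, where there is
  no pair \<open>i \<noteq> j\<close>; otherwise it has no effect, as probabilities are nonnegative.
\<close>

definition phi :: "'a set \<Rightarrow> nat \<Rightarrow> (nat \<Rightarrow> 'a set) \<Rightarrow> real \<Rightarrow> real" where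
  "phi X N E p = Max (insert 0
     {\<P>(W in random_subset X p. E i \<subseteq> W \<bar> E j \<subseteq> W) | i j. i \<in> {1..N} \<and> j \<in> {1..N} \<and> i \<noteq> j})"

definition R :: "(nat \<Rightarrow> 'a set) \<Rightarrow> nat set \<Rightarrow> 'a set" where
  "R E Y = (\<Union>j\<in>Y. E j)"

definition t :: "(nat \<Rightarrow> 'a set) \<Rightarrow> nat \<Rightarrow> nat set \<Rightarrow> int" where
  "t E s Y = int s * int (card Y) - int (card (R E Y))"

definition Q2 :: "nat \<Rightarrow> (nat \<Rightarrow> 'a set) \<Rightarrow> nat set \<Rightarrow> real" where
  "Q2 N E Y = 1/2 * (\<Sum>(i, j) \<in> {(i, j). i \<in> {1..N} \<and> j \<in> {1..N} \<and> adj E i j}.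
     of_bool (i \<in> Y \<and> j \<in> Y))"

definition Q3 :: "'a set \<Rightarrow> nat \<Rightarrow> (nat \<Rightarrow> 'a set) \<Rightarrow> real \<Rightarrow> nat set \<Rightarrow> real" where
  "Q3 X N E p Y =
     (\<Sum>(i, j, k) \<in> {(i, j, k). distinct [i, j, k] \<and> cluster N E 3 {i, j, k}}.
        of_bool (i \<in> Y \<and> j \<in> Y) * \<P>(W in random_subset X p. E k \<subseteq> W \<bar> E i \<subseteq> W))"

definition Q4 :: "'a set \<Rightarrow> nat \<Rightarrow> (nat \<Rightarrow> 'a set) \<Rightarrow> real \<Rightarrow> nat set \<Rightarrow> real" where
  "Q4 X N E p Y =
     (\<Sum>(i, i', j', j) \<in> {(i, i', j', j). {i, i', j', j} \<subseteq> {1..N} \<and> distinct [i, i', j', j] \<and>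
          adj E i i' \<and> adj E i' j' \<and> adj E j' j \<and> \<not> adj E i' j \<and> \<not> adj E i j'}.
        of_bool (i \<in> Y \<and> j \<in> Y) *
        \<P>(W in random_subset X p. E i' \<subseteq> W \<and> E j' \<subseteq> W \<bar> E i \<subseteq> W \<and> E j \<subseteq> W))"

end

theory Submission
  imports Defs
begin

text \<open>
  Conditionally on the edges of \<open>Y\<close> being contained in the random set, the vertices of \<open>R E Y\<close> are
  selected, which contributes the factor \<open>p ^ card (R E Y)\<close>, and no other edge may be completed by
  the remaining vertices. It suffices to forbid the edges with no neighbour in \<open>Y\<close> and those with
  exactly one. For the former, inserting the events one at a time and using Harris' inequality and
  the second Bonferroni inequality yields a form of Janson's inequality whose exponent contains
  \<open>Delta2 - Delta2_0\<close>, with an error of order \<open>\<phi> Delta2 + Delta3\<close>. For the latter the usual Janson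
  inequality suffices: if two such edges intersect, then either they touch \<open>Y\<close> in a common edge,
  giving a 3-cluster, or they are the middle of a path counted by \<open>Q4\<close>. Finally, the sum
  of the conditional probabilities of the forbidden edges exceeds \<open>\<pi> N\<close> by the sum over \<open>j \<in> Y\<close> and
  \<open>i \<sim> j\<close> of \<open>P(A_i | A_j) - \<pi>\<close>, up to \<open>\<phi> Q2 + Q3 + \<pi>\<^sup>2 N\<close>, and by symmetry each \<open>j \<in> Y\<close> contributes
  \<open>2 (Delta2 - Delta2_0) / \<mu>\<close>.
\<close>

subsection \<open>Random subsets\<close>

lemma set_pmf_random_subset: "set_pmf (random_subset X p) \<subseteq> Pow X"
  unfolding random_subset_def set_map_pmf by blast
lemma finite_set_pmf_random_subset: "finite X \<Longrightarrow> finite (set_pmf (random_subset X p))"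
  by (rule finite_subset[OF set_pmf_random_subset]) simp
lemma random_subset_empty: "random_subset {} p = return_pmf {}"
  unfolding random_subset_def by (simp add: map_pmf_const)

lemma random_subset_insert:
  assumes "finite X" "x \<notin> X"
  shows "random_subset (insert x X) p =
    bernoulli_pmf p \<bind> (\<lambda>b. map_pmf (\<lambda>W. if b then insert x W else W) (random_subset X p))"
proof -
  have eq: "{y. (y = x \<or> y \<in> X) \<and> (if y = x then b else f y)} =
        (if b then insert x {y\<in>X. f y} else {y\<in>X. f y})" for b f
    using assms(2) by auto
  have "random_subset (insert x X) p = map_pmf (\<lambda>f. {y\<in>insert x X. f y})
      (map_pmf (\<lambda>(b, f). f(x := b)) (pair_pmf (bernoulli_pmf p) (Pi_pmf X False (\<lambda>_. bernoulli_pmf p))))"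
    unfolding random_subset_def Pi_pmf_insert[OF assms] ..
  also have "\<dots> = bernoulli_pmf p \<bind> (\<lambda>b. Pi_pmf X False (\<lambda>_. bernoulli_pmf p) \<bind>
      (\<lambda>f. return_pmf (if b then insert x {y\<in>X. f y} else {y\<in>X. f y})))"
    by (simp only: pair_pmf_def map_pmf_def bind_assoc_pmf bind_return_pmf prod.case insert_iff fun_upd_apply eq)
  also have "\<dots> = bernoulli_pmf p \<bind> (\<lambda>b. map_pmf (\<lambda>W. if b then insert x W else W) (random_subset X p))"
    by (simp only: random_subset_def map_pmf_def bind_assoc_pmf bind_return_pmf)
  finally show ?thesis .
qed

section \<open>Expectations over the random subset, correlation and independence\<close>

abbreviation rexp :: "'a set \<Rightarrow> real \<Rightarrow> ('a set \<Rightarrow> real) \<Rightarrow> real" where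
  "rexp X p \<equiv> measure_pmf.expectation (random_subset X p)"

text \<open>Conditioning on whether the single vertex \<open>x\<close> is selected; this is the
  recursion behind the inductions on vertices below.\<close>

lemma rexp_insert:
  assumes "finite X" "x \<notin> X" "0 \<le> p" "p \<le> 1"
  shows "rexp (insert x X) p f = p * rexp X p (\<lambda>W. f (insert x W)) + (1 - p) * rexp X p f"
proof -
  have "rexp (insert x X) p f =
    (\<Sum>b\<in>UNIV. pmf (bernoulli_pmf p) b *\<^sub>R
       measure_pmf.expectation (map_pmf (\<lambda>W. if b then insert x W else W) (random_subset X p)) f)"
    unfolding random_subset_insert[OF assms(1,2)]
    using assms by (intro pmf_expectation_bind) (auto simp: finite_set_pmf_random_subset)
  then show ?thesis
    using assms by (simp add: UNIV_bool)
qed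

context
  fixes X :: "'a set" and p :: real
  assumes fin: "finite X"
begin

lemma integrable_random_subset: "integrable (measure_pmf (random_subset X p)) (f :: 'a set \<Rightarrow> real)"
  by (intro integrable_measure_pmf_finite finite_set_pmf_random_subset fin)

lemma rexp_add: "rexp X p (\<lambda>W. f W + g W) = rexp X p f + rexp X p g"
  by (intro Bochner_Integration.integral_add integrable_random_subset)

lemma rexp_diff: "rexp X p (\<lambda>W. f W - g W) = rexp X p f - rexp X p g"
  by (intro Bochner_Integration.integral_diff integrable_random_subset)

lemma rexp_sum: "rexp X p (\<lambda>W. \<Sum>i\<in>I. f i W) = (\<Sum>i\<in>I. rexp X p (f i))"
  by (intro Bochner_Integration.integral_sum integrable_random_subset)

lemma rexp_mono:
  assumes "\<And>W. W \<subseteq> X \<Longrightarrow> f W \<le> g W"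
  shows "rexp X p f \<le> rexp X p g"
  using assms set_pmf_random_subset[of X p]
  by (intro integral_mono_AE integrable_random_subset AE_pmfI) auto

lemma rexp_cong:
  assumes "\<And>W. W \<subseteq> X \<Longrightarrow> f W = g W"
  shows "rexp X p f = rexp X p g"
  using assms by (intro antisym rexp_mono) auto

lemma rexp_of_bool: "rexp X p (\<lambda>W. of_bool (P W)) = \<P>(W in random_subset X p. P W)"
proof -
  have "(\<lambda>W. of_bool (P W) :: real) = indicator {W. P W}"
    by (auto simp: fun_eq_iff indicator_def)
  then show ?thesis by simp
qed

end

text \<open>Induction on \<open>X\<close>: condition on the new vertex, apply the induction
  hypothesis to both outcomes, and compare the two-point averages by Chebyshev's sum inequality. As
  \<open>f\<close> increases and \<open>g\<close> decreases, the correlation is negative.\<close>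

lemma harris:
  assumes "finite X" "0 \<le> p" "p \<le> 1"
    and "\<And>U V. U \<subseteq> V \<Longrightarrow> V \<subseteq> X \<Longrightarrow> f U \<le> f V"
    and "\<And>U V. U \<subseteq> V \<Longrightarrow> V \<subseteq> X \<Longrightarrow> g V \<le> g U"
  shows "rexp X p (\<lambda>W. f W * g W) \<le> rexp X p f * rexp X p g"
  using assms(1,4,5)
proof (induction X arbitrary: f g rule: finite_induct)
  case empty
  then show ?case by (simp add: random_subset_empty)
next
  case (insert x X)
  let ?f1 = "rexp X p (\<lambda>W. f (insert x W))" and ?f0 = "rexp X p f"
  let ?g1 = "rexp X p (\<lambda>W. g (insert x W))" and ?g0 = "rexp X p g"
  have 1: "rexp X p (\<lambda>W. f (insert x W) * g (insert x W)) \<le> ?f1 * ?g1"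
    by (rule insert.IH) (rule insert.prems; blast)+
  have 0: "rexp X p (\<lambda>W. f W * g W) \<le> ?f0 * ?g0"
    by (rule insert.IH) (rule insert.prems; blast)+
  have "?f0 \<le> ?f1"
    by (intro rexp_mono insert.hyps insert.prems(1)) auto
  moreover have "?g1 \<le> ?g0"
    by (intro rexp_mono insert.hyps insert.prems(2)) auto
  \<comment> \<open>This quantity is exactly the gap between the product of the averages and the
    average of the products.\<close>
  ultimately have "0 \<le> p * (1 - p) * ((?f1 - ?f0) * (?g0 - ?g1))"
    using assms by (intro mult_nonneg_nonneg) auto
  also have "\<dots> = (p * ?f1 + (1 - p) * ?f0) * (p * ?g1 + (1 - p) * ?g0)
      - (p * (?f1 * ?g1) + (1 - p) * (?f0 * ?g0))"
    by (simp add: algebra_simps)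
  finally have "p * (?f1 * ?g1) + (1 - p) * (?f0 * ?g0) \<le>
      (p * ?f1 + (1 - p) * ?f0) * (p * ?g1 + (1 - p) * ?g0)" by simp
  moreover have "p * rexp X p (\<lambda>W. f (insert x W) * g (insert x W)) +
      (1 - p) * rexp X p (\<lambda>W. f W * g W) \<le> p * (?f1 * ?g1) + (1 - p) * (?f0 * ?g0)"
    using 1 0 assms by (intro add_mono mult_left_mono) auto
  ultimately show ?case
    using insert.hyps assms by (simp add: rexp_insert)
qed

text \<open>The last hypothesis says that \<open>g\<close> ignores the vertices of \<open>S\<close>,
  so \<open>g\<close> is independent of their selection. The vertices of \<open>S\<close> are split
  off one at a time.\<close>

lemma rexp_superset_indep:
  assumes "finite X" "0 \<le> p" "p \<le> 1" "S \<subseteq> X" and "\<And>W. g W = g (W - S)"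
  shows "rexp X p (\<lambda>W. of_bool (S \<subseteq> W) * g W) = p ^ card S * rexp X p g"
proof -
  have "finite S" using assms finite_subset by blast
  then show ?thesis
    using assms(4,5)
  proof (induction S arbitrary: g rule: finite_induct)
    case empty
    then show ?case by simp
  next
    case (insert x S)
    define X' where "X' = X - {x}"
    have X': "finite X'" "x \<notin> X'" "X = insert x X'"
      using insert assms by (auto simp: X'_def)
    have gx: "g (insert x W) = g W" for W
      using insert.prems(2)[of "insert x W"] insert.prems(2)[of W] by simp
    have "rexp X p (\<lambda>W. of_bool (insert x S \<subseteq> W) * g W) =
        rexp X p (\<lambda>W. of_bool (S \<subseteq> W) * (of_bool (x \<in> W) * g W))"
      by (rule arg_cong[where f = "rexp X p"]) auto
    also have "\<dots> = p ^ card S * rexp X p (\<lambda>W. of_bool (x \<in> W) * g W)"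
    proof (rule insert.IH)
      fix W
      have "g (W - S) = g (W - S - insert x S)" using insert.prems(2) by blast
      also have "W - S - insert x S = W - insert x S" by blast
      also have "g \<dots> = g W" using insert.prems(2)[of W] by simp
      finally have "g W = g (W - S)" by simp
      then show "of_bool (x \<in> W) * g W = of_bool (x \<in> W - S) * g (W - S)"
        using insert.hyps by simp
    qed (use insert in auto)
    also have "rexp X p (\<lambda>W. of_bool (x \<in> W) * g W) = p * rexp X p g"
    proof -
      \<comment> \<open>Subsets of \<open>X'\<close> never contain \<open>x\<close>, so only the
        branch selecting \<open>x\<close> contributes.\<close>
      have "rexp X' p (\<lambda>W. of_bool (x \<in> W) * g W) = rexp X' p (\<lambda>_. 0)"
        using X' by (intro rexp_cong) auto
      then show ?thesis
        using X' assms by (simp add: rexp_insert gx algebra_simps)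
    qed
    finally show ?case using insert.hyps by simp
  qed
qed

lemma rexp_superset:
  assumes "finite X" "0 \<le> p" "p \<le> 1" "S \<subseteq> X"
  shows "rexp X p (\<lambda>W. of_bool (S \<subseteq> W)) = p ^ card S"
  using rexp_superset_indep[OF assms, of "\<lambda>_. 1"] by simp

lemma prob_superset:
  assumes "finite X" "0 \<le> p" "p \<le> 1" "S \<subseteq> X"
  shows "\<P>(W in random_subset X p. S \<subseteq> W) = p ^ card S"
  using rexp_superset[OF assms] rexp_of_bool[OF assms(1)] by metis

text \<open>Turns the conditional probabilities in \<phi>, \<open>Q3\<close> and \<open>Q4\<close>
  into powers of \<open>p\<close>; \<open>0 < p\<close> makes the conditioning event have positive
  probability.\<close>

lemma cond_prob_superset:
  assumes "finite X" "0 < p" "p \<le> 1" "S \<subseteq> X" "T \<subseteq> X"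
  shows "\<P>(W in random_subset X p. S \<subseteq> W \<bar> T \<subseteq> W) = p ^ card (S - T)"
proof -
  have "\<P>(W in random_subset X p. S \<subseteq> W \<and> T \<subseteq> W) = p ^ card (S \<union> T)"
    using prob_superset[of X p "S \<union> T"] assms by simp
  moreover have "card (S \<union> T) = card (S - T) + card T"
    using assms card_Un_disjoint[of "S - T" T] finite_subset[of _ X] by (simp add: Int_commute)
  ultimately show ?thesis
    using assms prob_superset[of X p T] by (simp add: cond_prob_def power_add)
qed

subsection \<open>A refined Janson inequality\<close>

definition avoid :: "'a set \<Rightarrow> real \<Rightarrow> (nat \<Rightarrow> 'a set) \<Rightarrow> nat set \<Rightarrow> real" where
  "avoid X p S T = rexp X p (\<lambda>W. of_bool (\<forall>j\<in>T. \<not> S j \<subseteq> W))"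

definition nbrs :: "(nat \<Rightarrow> 'a set) \<Rightarrow> nat set \<Rightarrow> nat \<Rightarrow> nat set" where
  "nbrs S T i = {j\<in>T. adj S i j}"

text \<open>
  Inserting an index \<open>i\<close> into an avoided set \<open>T\<close> costs the factor
  \<open>1 - q + (a - q b) + (a b + q e)\<close>, where \<open>q\<close> is the probability of the \<open>i\<close>-th event,
  \<open>a\<close> sums the pair probabilities with the neighbours of \<open>i\<close> in \<open>T\<close>, \<open>b\<close> sums the
  probabilities of these neighbours, and \<open>e\<close> bounds the error in the second Bonferroni
  inequality for them. The last bracket is the error term defined here.
\<close>

definition janson_error :: "real \<Rightarrow> (nat \<Rightarrow> 'a set) \<Rightarrow> nat set \<Rightarrow> nat \<Rightarrow> real" where
  "janson_error p S T i =
     (\<Sum>j\<in>nbrs S T i. p ^ card (S i \<union> S j)) * (\<Sum>j\<in>nbrs S T i. p ^ card (S j)) +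
     p ^ card (S i) * (\<Sum>j\<in>nbrs S T i. \<Sum>k\<in>{k\<in>T - {i, j}. adj S j k \<or> adj S i k}. p ^ card (S j \<union> S k))"

lemma adj_sym: "adj S i j \<longleftrightarrow> adj S j i"
  by (auto simp: adj_def)

lemma finite_nbrs [simp, intro]: "finite T \<Longrightarrow> finite (nbrs S T i)"
  by (simp add: nbrs_def)

lemma nbrs_mono: "T \<subseteq> T' \<Longrightarrow> nbrs S T i \<subseteq> nbrs S T' i"
  by (auto simp: nbrs_def)

lemma janson_error_mono:
  assumes "T \<subseteq> T'" "finite T'" "0 \<le> p"
  shows "janson_error p S T i \<le> janson_error p S T' i"
proof -
  have fin: "finite T" using assms finite_subset by blast
  have n: "nbrs S T i \<subseteq> nbrs S T' i" by (rule nbrs_mono) fact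
  show ?thesis
    unfolding janson_error_def
  proof (intro add_mono mult_mono mult_left_mono)
    show "(\<Sum>j\<in>nbrs S T i. \<Sum>k\<in>{k\<in>T - {i, j}. adj S j k \<or> adj S i k}. p ^ card (S j \<union> S k))
      \<le> (\<Sum>j\<in>nbrs S T' i. \<Sum>k\<in>{k\<in>T' - {i, j}. adj S j k \<or> adj S i k}. p ^ card (S j \<union> S k))"
      (is "?l \<le> ?r")
    proof -
      have "?l \<le> (\<Sum>j\<in>nbrs S T i. \<Sum>k\<in>{k\<in>T' - {i, j}. adj S j k \<or> adj S i k}. p ^ card (S j \<union> S k))"
        using assms by (intro sum_mono sum_mono2) auto
      also have "\<dots> \<le> ?r"
        using assms n by (intro sum_mono2 sum_nonneg) auto
      finally show ?thesis .
    qed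
  qed (use assms n in \<open>auto intro!: sum_mono2 sum_nonneg\<close>)
qed

text \<open>If \<open>n\<close> events hold, the right-hand side is
  \<open>1 - n + n * (n - 1) = (n - 1)^2\<close>. The double sum runs over ordered pairs, so the
  quadratic term is twice the one in Bonferroni's inequality; this costs only a constant.\<close>

lemma of_bool_none_le:
  assumes "finite J"
  shows "of_bool (\<forall>j\<in>J. \<not> P j) \<le>
    (1::real) - (\<Sum>j\<in>J. of_bool (P j)) + (\<Sum>j\<in>J. \<Sum>k\<in>J - {j}. of_bool (P j \<and> P k))"
proof -
  define n where "n = (\<Sum>j\<in>J. of_bool (P j) :: real)"
  have n: "n = real (card {j\<in>J. P j})"
    using assms by (simp add: n_def Int_def)
  have "(\<Sum>k\<in>J - {j}. of_bool (P j \<and> P k)) = of_bool (P j) * (n - 1)" if "j \<in> J" for j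
    using that assms unfolding n_def of_bool_conj sum_distrib_left[symmetric] sum.remove[OF assms that]
    by (cases "P j") simp_all
  then have "(\<Sum>j\<in>J. \<Sum>k\<in>J - {j}. of_bool (P j \<and> P k)) = n * (n - 1)"
    by (simp add: n_def sum_distrib_right del: sum_of_bool_eq)
  moreover have "of_bool (\<forall>j\<in>J. \<not> P j) \<le> 1 - n + n * (n - 1)"
  proof (cases "\<forall>j\<in>J. \<not> P j")
    case True
    then have "n = 0" by (simp add: n_def)
    then show ?thesis by simp
  next
    case False
    have "0 \<le> (n - 1) * (n - 1)" by simp
    moreover have "of_bool (\<forall>j\<in>J. \<not> P j) = (0::real)" using False by simp
    ultimately show ?thesis by (simp only: algebra_simps)
  qed
  ultimately show ?thesis unfolding n_def by simp
qed

section \<open>Janson-type bounds by inserting indices one at a time\<close>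

context
  fixes X :: "'a set" and p :: real and S :: "nat \<Rightarrow> 'a set"
  assumes fin: "finite X" and p: "0 \<le> p" "p \<le> 1"
begin

lemma avoid_nonneg: "0 \<le> avoid X p S T"
  by (auto simp: avoid_def)

lemma avoid_antimono: "T \<subseteq> T' \<Longrightarrow> avoid X p S T' \<le> avoid X p S T"
  unfolding avoid_def by (intro rexp_mono fin) auto

lemma avoid_empty: "avoid X p S {} = 1"
  by (simp add: avoid_def)

text \<open>Harris' inequality: containing \<open>U\<close> is an increasing event, avoiding the
  \<open>S j\<close> a decreasing one.\<close>

lemma superset_avoid_le:
  assumes "U \<subseteq> X"
  shows "rexp X p (\<lambda>W. of_bool (U \<subseteq> W) * of_bool (\<forall>j\<in>T. \<not> S j \<subseteq> W)) \<le> p ^ card U * avoid X p S T"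
  unfolding avoid_def rexp_superset[OF fin p assms, symmetric]
  by (intro harris fin p) (auto dest: order_trans)

lemma superset_avoid_indep:
  assumes "S i \<subseteq> X" "\<And>j. j \<in> T \<Longrightarrow> S j \<inter> S i = {}"
  shows "rexp X p (\<lambda>W. of_bool (S i \<subseteq> W) * of_bool (\<forall>j\<in>T. \<not> S j \<subseteq> W)) = p ^ card (S i) * avoid X p S T"
  unfolding avoid_def
proof (rule rexp_superset_indep[OF fin p assms(1)])
  fix W
  have "S j \<subseteq> W \<longleftrightarrow> S j \<subseteq> W - S i" if "j \<in> T" for j
    using assms(2)[OF that] by auto
  then show "of_bool (\<forall>j\<in>T. \<not> S j \<subseteq> W) = of_bool (\<forall>j\<in>T. \<not> S j \<subseteq> W - S i)"
    by auto
qed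

text \<open>Removing the neighbours of \<open>i\<close> leaves an avoided family independent of
  \<open>S i\<close>. The removed constraints are restored by a union bound, whose terms are
  controlled by Harris' inequality.\<close>

lemma superset_avoid_ge:
  assumes "finite T" "i \<notin> T" "S i \<subseteq> X" "\<And>j. j \<in> T \<Longrightarrow> S j \<subseteq> X"
  shows "rexp X p (\<lambda>W. of_bool (S i \<subseteq> W) * of_bool (\<forall>j\<in>T. \<not> S j \<subseteq> W)) \<ge>
    (p ^ card (S i) - (\<Sum>j\<in>nbrs S T i. p ^ card (S i \<union> S j))) * avoid X p S (T - nbrs S T i)"
proof -
  define J where "J = nbrs S T i"
  define C where "C = T - J"
  have J: "finite J" "J \<subseteq> T" using assms by (auto simp: J_def nbrs_def)
  let ?c = "\<lambda>W. of_bool (\<forall>j\<in>C. \<not> S j \<subseteq> W) :: real"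
  have "rexp X p (\<lambda>W. of_bool (S i \<subseteq> W) * of_bool (\<forall>j\<in>T. \<not> S j \<subseteq> W)) \<ge>
     rexp X p (\<lambda>W. of_bool (S i \<subseteq> W) * ?c W - (\<Sum>j\<in>J. of_bool (S i \<union> S j \<subseteq> W) * ?c W))"
  proof (rule rexp_mono[OF fin])
    fix W
    have nn: "0 \<le> (\<Sum>j\<in>J. of_bool (S i \<union> S j \<subseteq> W) * ?c W)" by (auto intro!: sum_nonneg)
    show "of_bool (S i \<subseteq> W) * ?c W - (\<Sum>j\<in>J. of_bool (S i \<union> S j \<subseteq> W) * ?c W) \<le>
          of_bool (S i \<subseteq> W) * of_bool (\<forall>j\<in>T. \<not> S j \<subseteq> W)"
    \<comment> \<open>Only here does dropping the neighbours overcount, and then the subtracted sum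
      is at least 1.\<close>
    proof (cases "S i \<subseteq> W \<and> (\<forall>j\<in>C. \<not> S j \<subseteq> W) \<and> (\<exists>j\<in>J. S j \<subseteq> W)")
      case True
      then obtain j where j: "j \<in> J" "S j \<subseteq> W" by blast
      have "(1::real) = of_bool (S i \<union> S j \<subseteq> W) * ?c W" using j True by auto
      also have "\<dots> \<le> (\<Sum>j\<in>J. of_bool (S i \<union> S j \<subseteq> W) * ?c W)"
        using j J by (intro member_le_sum) auto
      finally show ?thesis by (auto simp: True)
    next
      case False
      then have "of_bool (S i \<subseteq> W) * ?c W \<le> of_bool (S i \<subseteq> W) * of_bool (\<forall>j\<in>T. \<not> S j \<subseteq> W)"
        by (auto simp: C_def)
      then show ?thesis using nn by linarith
    qed
  qed
  also have "rexp X p (\<lambda>W. of_bool (S i \<subseteq> W) * ?c W - (\<Sum>j\<in>J. of_bool (S i \<union> S j \<subseteq> W) * ?c W)) =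
     rexp X p (\<lambda>W. of_bool (S i \<subseteq> W) * ?c W) - (\<Sum>j\<in>J. rexp X p (\<lambda>W. of_bool (S i \<union> S j \<subseteq> W) * ?c W))"
    by (simp only: rexp_diff[OF fin] rexp_sum[OF fin])
  also have "rexp X p (\<lambda>W. of_bool (S i \<subseteq> W) * ?c W) = p ^ card (S i) * avoid X p S C"
    using assms by (intro superset_avoid_indep) (auto simp: C_def J_def nbrs_def adj_def)
  finally have ge: "p ^ card (S i) * avoid X p S C - (\<Sum>j\<in>J. rexp X p (\<lambda>W. of_bool (S i \<union> S j \<subseteq> W) * ?c W))
     \<le> rexp X p (\<lambda>W. of_bool (S i \<subseteq> W) * of_bool (\<forall>j\<in>T. \<not> S j \<subseteq> W))" .
  have "(\<Sum>j\<in>J. rexp X p (\<lambda>W. of_bool (S i \<union> S j \<subseteq> W) * ?c W)) \<le>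
      (\<Sum>j\<in>J. p ^ card (S i \<union> S j) * avoid X p S C)"
    using assms J by (intro sum_mono superset_avoid_le) auto
  also have "\<dots> = (\<Sum>j\<in>J. p ^ card (S i \<union> S j)) * avoid X p S C"
    by (simp add: sum_distrib_right)
  finally show ?thesis
    using ge unfolding J_def[symmetric] C_def[symmetric] left_diff_distrib by linarith
qed

lemma avoid_insert:
  assumes "i \<notin> T"
  shows "avoid X p S (insert i T) =
    avoid X p S T - rexp X p (\<lambda>W. of_bool (S i \<subseteq> W) * of_bool (\<forall>j\<in>T. \<not> S j \<subseteq> W))"
  unfolding avoid_def rexp_diff[OF fin, symmetric]
  by (rule rexp_cong[OF fin]) auto

text \<open>The step of the usual Janson inequality: the probability drops by at least the fraction
  \<open>a\<close>, and \<open>1 - a \<le> exp (- a)\<close>.\<close>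

lemma avoid_insert_le:
  assumes "finite T" "i \<notin> T" "S i \<subseteq> X" "\<And>j. j \<in> T \<Longrightarrow> S j \<subseteq> X"
  shows "avoid X p S (insert i T) \<le>
    avoid X p S T * exp (- (p ^ card (S i)) + (\<Sum>j\<in>nbrs S T i. p ^ card (S i \<union> S j)))"
proof -
  define M where "M = rexp X p (\<lambda>W. of_bool (S i \<subseteq> W) * of_bool (\<forall>j\<in>T. \<not> S j \<subseteq> W))"
  define a where "a = p ^ card (S i) - (\<Sum>j\<in>nbrs S T i. p ^ card (S i \<union> S j))"
  have "a * avoid X p S T \<le> M"
  \<comment> \<open>The lower bound on \<open>M\<close> involves the larger probability of avoiding
    the non-neighbours only; passing to \<open>avoid X p S T\<close> requires a nonnegative factor.
    A negative \<open>a\<close> makes the claim trivial.\<close>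
  proof (cases "a \<ge> 0")
    case True
    then have "a * avoid X p S T \<le> a * avoid X p S (T - nbrs S T i)"
      by (intro mult_left_mono avoid_antimono) auto
    also have "\<dots> \<le> M" unfolding M_def a_def by (rule superset_avoid_ge[OF assms])
    finally show ?thesis .
  next
    case False
    then have "a * avoid X p S T \<le> 0" using avoid_nonneg by (simp add: mult_nonpos_nonneg)
    also have "0 \<le> M" by (auto simp: M_def)
    finally show ?thesis .
  qed
  then have "avoid X p S (insert i T) \<le> avoid X p S T * (1 + (- a))"
    by (simp add: avoid_insert[OF assms(2)] M_def algebra_simps)
  also have "\<dots> \<le> avoid X p S T * exp (- a)"
    by (intro mult_left_mono exp_ge_add_one_self avoid_nonneg)
  finally show ?thesis by (simp add: a_def)
qed

text \<open>
  Bonferroni for the events indexed by the neighbours of \<open>i\<close>, conditionally on avoiding the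
  other ones; the joint probabilities are controlled by Harris' inequality.
\<close>

lemma avoid_le_avoid_non_nbrs:
  assumes "finite T" "i \<notin> T" "\<And>j. j \<in> T \<Longrightarrow> S j \<subseteq> X"
  shows "avoid X p S T \<le> avoid X p S (T - nbrs S T i) *
    (1 - (\<Sum>j\<in>nbrs S T i. p ^ card (S j)) +
      (\<Sum>j\<in>nbrs S T i. \<Sum>k\<in>{k\<in>T - {i, j}. adj S j k \<or> adj S i k}. p ^ card (S j \<union> S k)))"
proof -
  define J where "J = nbrs S T i"
  define C where "C = T - J"
  define D where "D = avoid X p S C"
  have J: "finite J" "J \<subseteq> T" "finite C" using assms by (auto simp: J_def C_def nbrs_def)
  let ?c = "\<lambda>W. of_bool (\<forall>j\<in>C. \<not> S j \<subseteq> W) :: real"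
  have "avoid X p S T \<le> rexp X p (\<lambda>W. ?c W - (\<Sum>j\<in>J. of_bool (S j \<subseteq> W) * ?c W) +
      (\<Sum>j\<in>J. \<Sum>k\<in>J - {j}. of_bool (S j \<union> S k \<subseteq> W) * ?c W))"
    unfolding avoid_def
  proof (rule rexp_mono[OF fin])
    fix W
    have "of_bool (\<forall>j\<in>T. \<not> S j \<subseteq> W) = of_bool (\<forall>j\<in>J. \<not> S j \<subseteq> W) * ?c W"
      using J by (auto simp: C_def)
    also have "\<dots> \<le> (1 - (\<Sum>j\<in>J. of_bool (S j \<subseteq> W)) + (\<Sum>j\<in>J. \<Sum>k\<in>J - {j}. of_bool (S j \<subseteq> W \<and> S k \<subseteq> W))) * ?c W"
      by (rule mult_right_mono[OF of_bool_none_le]) (use J in auto)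
    finally show "of_bool (\<forall>j\<in>T. \<not> S j \<subseteq> W) \<le> ?c W - (\<Sum>j\<in>J. of_bool (S j \<subseteq> W) * ?c W) +
      (\<Sum>j\<in>J. \<Sum>k\<in>J - {j}. of_bool (S j \<union> S k \<subseteq> W) * ?c W)"
      by (simp only: Un_subset_iff distrib_right left_diff_distrib mult_1_left sum_distrib_right)
  qed
  also have "\<dots> = D - (\<Sum>j\<in>J. rexp X p (\<lambda>W. of_bool (S j \<subseteq> W) * ?c W)) +
      (\<Sum>j\<in>J. \<Sum>k\<in>J - {j}. rexp X p (\<lambda>W. of_bool (S j \<union> S k \<subseteq> W) * ?c W))"
    by (simp only: rexp_diff[OF fin] rexp_add[OF fin] rexp_sum[OF fin] avoid_def D_def)
  \<comment> \<open>The subtracted single terms need lower bounds, which bring in the neighbours of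
    \<open>j\<close> in \<open>C\<close>; the added pair terms only need Harris' upper
    bound.\<close>
  also have "\<dots> \<le> D - (\<Sum>j\<in>J. (p ^ card (S j) - (\<Sum>k\<in>nbrs S C j. p ^ card (S j \<union> S k))) * D) +
      (\<Sum>j\<in>J. \<Sum>k\<in>J - {j}. p ^ card (S j \<union> S k) * D)"
  proof (intro add_mono diff_mono sum_mono order_refl)
    fix j k assume "j \<in> J" "k \<in> J - {j}"
    then show "rexp X p (\<lambda>W. of_bool (S j \<union> S k \<subseteq> W) * ?c W) \<le> p ^ card (S j \<union> S k) * D"
      unfolding D_def using J assms by (intro superset_avoid_le) auto
  next
    fix j assume j: "j \<in> J"
    let ?a = "p ^ card (S j) - (\<Sum>k\<in>nbrs S C j. p ^ card (S j \<union> S k))"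
    show "?a * D \<le> rexp X p (\<lambda>W. of_bool (S j \<subseteq> W) * ?c W)"
    proof (cases "?a \<ge> 0")
      case True
      then have "?a * D \<le> ?a * avoid X p S (C - nbrs S C j)"
        unfolding D_def by (intro mult_left_mono avoid_antimono) auto
      also have "\<dots> \<le> rexp X p (\<lambda>W. of_bool (S j \<subseteq> W) * ?c W)"
        using j J assms by (intro superset_avoid_ge) (auto simp: C_def)
      finally show ?thesis .
    next
      case False
      then have "?a * D \<le> 0" using avoid_nonneg by (simp add: mult_nonpos_nonneg D_def)
      also have "0 \<le> rexp X p (\<lambda>W. of_bool (S j \<subseteq> W) * ?c W)" by auto
      finally show ?thesis .
    qed
  qed
  also have "\<dots> = D * (1 - (\<Sum>j\<in>J. p ^ card (S j)) +
      (\<Sum>j\<in>J. (\<Sum>k\<in>nbrs S C j. p ^ card (S j \<union> S k)) + (\<Sum>k\<in>J - {j}. p ^ card (S j \<union> S k))))"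
    by (simp add: sum.distrib sum_subtractf sum_distrib_left sum_distrib_right algebra_simps)
  \<comment> \<open>The two inner ranges are disjoint: \<open>k\<close> in \<open>C\<close> is
    adjacent to \<open>j\<close>, while \<open>k\<close> in \<open>J\<close> is adjacent to
    \<open>i\<close>.\<close>
  also have "(\<Sum>j\<in>J. (\<Sum>k\<in>nbrs S C j. p ^ card (S j \<union> S k)) + (\<Sum>k\<in>J - {j}. p ^ card (S j \<union> S k))) \<le>
     (\<Sum>j\<in>J. \<Sum>k\<in>{k\<in>T - {i, j}. adj S j k \<or> adj S i k}. p ^ card (S j \<union> S k))"
  proof (rule sum_mono)
    fix j assume j: "j \<in> J"
    have "(\<Sum>k\<in>nbrs S C j. p ^ card (S j \<union> S k)) + (\<Sum>k\<in>J - {j}. p ^ card (S j \<union> S k)) =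
        (\<Sum>k\<in>nbrs S C j \<union> (J - {j}). p ^ card (S j \<union> S k))"
      using J by (intro sum.union_disjoint[symmetric]) (auto simp: C_def nbrs_def)
    also have "\<dots> \<le> (\<Sum>k\<in>{k\<in>T - {i, j}. adj S j k \<or> adj S i k}. p ^ card (S j \<union> S k))"
      using J j assms p by (intro sum_mono2) (auto simp: C_def J_def nbrs_def adj_def)
    finally show "(\<Sum>k\<in>nbrs S C j. p ^ card (S j \<union> S k)) + (\<Sum>k\<in>J - {j}. p ^ card (S j \<union> S k)) \<le>
       (\<Sum>k\<in>{k\<in>T - {i, j}. adj S j k \<or> adj S i k}. p ^ card (S j \<union> S k))" .
  qed
  finally show ?thesis
    using avoid_nonneg[of C] by (simp add: J_def C_def D_def mult_left_mono)
qed

text \<open>The gain over \<open>avoid_insert_le\<close> is the term \<open>- q * b\<close>: the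
  lower bound for \<open>M\<close> involves \<open>D'\<close>, which exceeds \<open>D\<close> by a
  factor of about \<open>1 + b\<close>, and this factor is retained here.\<close>

lemma avoid_insert_le_refined:
  assumes "finite T" "i \<notin> T" "S i \<subseteq> X" "\<And>j. j \<in> T \<Longrightarrow> S j \<subseteq> X"
  shows "avoid X p S (insert i T) \<le> avoid X p S T * exp (- (p ^ card (S i)) +
    (\<Sum>j\<in>nbrs S T i. p ^ card (S i \<union> S j) - p ^ card (S i) * p ^ card (S j)) + janson_error p S T i)"
proof -
  define M where "M = rexp X p (\<lambda>W. of_bool (S i \<subseteq> W) * of_bool (\<forall>j\<in>T. \<not> S j \<subseteq> W))"
  define q where "q = p ^ card (S i)"
  define a where "a = (\<Sum>j\<in>nbrs S T i. p ^ card (S i \<union> S j))"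
  define b where "b = (\<Sum>j\<in>nbrs S T i. p ^ card (S j))"
  define e where "e = (\<Sum>j\<in>nbrs S T i. \<Sum>k\<in>{k\<in>T - {i, j}. adj S j k \<or> adj S i k}. p ^ card (S j \<union> S k))"
  define D where "D = avoid X p S T"
  define D' where "D' = avoid X p S (T - nbrs S T i)"
  have nn: "0 \<le> q" "0 \<le> a" "0 \<le> b" "0 \<le> e" "0 \<le> D" "0 \<le> M"
    using p by (auto simp: q_def a_def b_def e_def D_def M_def avoid_nonneg intro!: sum_nonneg)
  have "D \<le> D'" unfolding D_def D'_def by (rule avoid_antimono) auto
  have M: "(q - a) * D' \<le> M"
    unfolding q_def a_def D'_def M_def by (rule superset_avoid_ge[OF assms])
  have D: "D \<le> D' * (1 - b + e)"
    unfolding D_def D'_def b_def e_def by (rule avoid_le_avoid_non_nbrs) (use assms in auto)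
  have "((q - a) * (1 + b) - q * e) * D \<le> M"
  proof (cases "q - a \<ge> 0 \<and> 1 + b - e \<ge> 0")
    case True
    have "(q - a) * (1 + b) - q * e \<le> (q - a) * (1 + b - e)"
      using nn by (simp add: algebra_simps)
    then have "((q - a) * (1 + b) - q * e) * D \<le> (q - a) * ((1 + b - e) * D)"
      using nn mult_right_mono by fastforce
    also have "\<dots> \<le> (q - a) * ((1 + b - e) * (D' * (1 - b + e)))"
      using True D by (intro mult_left_mono) auto
    also have "(1 + b - e) * (D' * (1 - b + e)) = D' * (1 - (b - e)\<^sup>2)"
      by (simp add: algebra_simps power2_eq_square)
    also have "(q - a) * \<dots> \<le> (q - a) * (D' * 1)"
      using True nn \<open>D \<le> D'\<close> by (intro mult_left_mono) auto
    finally show ?thesis using M by simp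
  next
    case False
    have "(q - a) * (1 + b) - q * e \<le> 0"
    proof (cases "q - a \<ge> 0")
      case True
      then have "q * (1 + b - e) \<le> 0" using False nn by (intro mult_nonneg_nonpos) auto
      moreover have "a * (1 + b) \<ge> 0" using nn by simp
      ultimately show ?thesis by (simp add: algebra_simps)
    next
      case False
      then have "(q - a) * (1 + b) \<le> 0" using nn by (intro mult_nonpos_nonneg) auto
      moreover have "q * e \<ge> 0" using nn by simp
      ultimately show ?thesis by simp
    qed
    then have "((q - a) * (1 + b) - q * e) * D \<le> 0" using nn by (simp add: mult_nonpos_nonneg)
    then show ?thesis using nn by simp
  qed
  then have "avoid X p S (insert i T) \<le> D * (1 + (- q + (a - q * b) + (a * b + q * e)))"
    by (simp add: avoid_insert[OF assms(2)] M_def D_def algebra_simps)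
  also have "\<dots> \<le> D * exp (- q + (a - q * b) + (a * b + q * e))"
    using nn by (intro mult_left_mono exp_ge_add_one_self)
  also have "a - q * b = (\<Sum>j\<in>nbrs S T i. p ^ card (S i \<union> S j) - p ^ card (S i) * p ^ card (S j))"
    by (simp add: a_def q_def b_def sum_subtractf sum_distrib_left)
  also have "a * b + q * e = janson_error p S T i"
    by (simp add: janson_error_def a_def b_def e_def q_def)
  finally show ?thesis by (simp add: q_def D_def)
qed

text \<open>Each adjacent pair contributes once, when its later index is inserted; the factor 1/2
  corrects for the sum over ordered pairs. The errors grow with \<open>T\<close>, so all may be
  taken at the final set.\<close>

lemma refined_janson:
  assumes "finite T" "\<And>j. j \<in> T \<Longrightarrow> S j \<subseteq> X"
  shows "avoid X p S T \<le> exp (- (\<Sum>i\<in>T. p ^ card (S i)) +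
    1/2 * (\<Sum>i\<in>T. \<Sum>j\<in>nbrs S T i. p ^ card (S i \<union> S j) - p ^ card (S i) * p ^ card (S j)) +
    (\<Sum>i\<in>T. janson_error p S T i))"
  using assms
proof (induction T rule: finite_induct)
  case empty
  then show ?case by (simp add: avoid_empty)
next
  case (insert i T)
  define f where "f i j = p ^ card (S i \<union> S j) - p ^ card (S i) * p ^ card (S j)" for i j
  have fsym: "f i j = f j i" for i j by (simp add: f_def Un_commute mult.commute)
  define I where "I = insert i T"
  have nI: "nbrs S I i = nbrs S T i" using insert by (auto simp: I_def nbrs_def adj_def)
  have "(\<Sum>j\<in>nbrs S I k. f k j) = (\<Sum>j\<in>nbrs S T k. f k j) + (if k \<in> nbrs S T i then f k i else 0)"
    if "k \<in> T" for k
  proof -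
    have "nbrs S I k = (if k \<in> nbrs S T i then insert i (nbrs S T k) else nbrs S T k)"
      using that insert by (auto simp: I_def nbrs_def adj_sym)
    moreover have "i \<notin> nbrs S T k" using insert by (auto simp: nbrs_def)
    ultimately show ?thesis using insert by simp
  qed
  then have "(\<Sum>k\<in>T. \<Sum>j\<in>nbrs S I k. f k j) =
     (\<Sum>k\<in>T. \<Sum>j\<in>nbrs S T k. f k j) + (\<Sum>k\<in>T. if k \<in> nbrs S T i then f k i else 0)"
    by (simp add: sum.distrib)
  also have "(\<Sum>k\<in>T. if k \<in> nbrs S T i then f k i else 0) = (\<Sum>k\<in>nbrs S T i. f i k)"
    using insert by (simp add: sum.If_cases fsym[of i] nbrs_def Int_def cong: conj_cong)
  finally have pairs: "1/2 * (\<Sum>k\<in>I. \<Sum>j\<in>nbrs S I k. f k j) =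
      1/2 * (\<Sum>k\<in>T. \<Sum>j\<in>nbrs S T k. f k j) + (\<Sum>j\<in>nbrs S T i. f i j)"
    using insert by (simp add: I_def[symmetric] sum.insert[of T i, folded I_def] nI)
  have err: "(\<Sum>k\<in>T. janson_error p S T k) + janson_error p S T i \<le> (\<Sum>k\<in>I. janson_error p S I k)"
  proof -
    have "(\<Sum>k\<in>I. janson_error p S T k) \<le> (\<Sum>k\<in>I. janson_error p S I k)"
      using insert p by (intro sum_mono janson_error_mono) (auto simp: I_def)
    then show ?thesis using insert by (simp add: I_def)
  qed
  have "avoid X p S I \<le> avoid X p S T * exp (- (p ^ card (S i)) +
    (\<Sum>j\<in>nbrs S T i. f i j) + janson_error p S T i)"
    unfolding I_def f_def using insert by (intro avoid_insert_le_refined) auto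
  also have "\<dots> \<le> exp (- (\<Sum>i\<in>T. p ^ card (S i)) +
      1/2 * (\<Sum>i\<in>T. \<Sum>j\<in>nbrs S T i. f i j) + (\<Sum>i\<in>T. janson_error p S T i)) *
      exp (- (p ^ card (S i)) + (\<Sum>j\<in>nbrs S T i. f i j) + janson_error p S T i)"
    using insert by (intro mult_right_mono) (auto simp: f_def)
  also have "\<dots> \<le> exp (- (\<Sum>i\<in>I. p ^ card (S i)) +
      1/2 * (\<Sum>i\<in>I. \<Sum>j\<in>nbrs S I i. f i j) + (\<Sum>i\<in>I. janson_error p S I i))"
    unfolding exp_add[symmetric] pairs using err insert by (simp add: I_def)
  finally show ?case by (simp add: I_def f_def)
qed

text \<open>The indices of \<open>T'\<close> are inserted after those of \<open>T\<close> by the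
  cruder step, so a refined bound for \<open>T\<close> survives. Pairs inside \<open>T'\<close> are
  counted twice, which is harmless in an error term.\<close>

lemma janson_extend:
  assumes "finite T" "finite T'" "T \<inter> T' = {}" "\<And>j. j \<in> T \<union> T' \<Longrightarrow> S j \<subseteq> X"
  shows "avoid X p S (T \<union> T') \<le> avoid X p S T * exp (- (\<Sum>i\<in>T'. p ^ card (S i)) +
    (\<Sum>i\<in>T'. \<Sum>j\<in>nbrs S (T \<union> T') i. p ^ card (S i \<union> S j)))"
  using assms(2,1,3,4)
proof (induction T' rule: finite_induct)
  case empty
  then show ?case by simp
next
  case (insert i T')
  let ?I = "T \<union> insert i T'"
  let ?f = "\<lambda>i j. p ^ card (S i \<union> S j)"
  have "avoid X p S ?I = avoid X p S (insert i (T \<union> T'))" by simp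
  also have "\<dots> \<le> avoid X p S (T \<union> T') * exp (- (p ^ card (S i)) + (\<Sum>j\<in>nbrs S (T \<union> T') i. ?f i j))"
    using insert by (intro avoid_insert_le) auto
  also have "\<dots> \<le> (avoid X p S T * exp (- (\<Sum>i\<in>T'. p ^ card (S i)) +
      (\<Sum>i\<in>T'. \<Sum>j\<in>nbrs S (T \<union> T') i. ?f i j))) *
      exp (- (p ^ card (S i)) + (\<Sum>j\<in>nbrs S (T \<union> T') i. ?f i j))"
    using insert by (intro mult_right_mono insert.IH) auto
  also have "\<dots> = avoid X p S T * exp (- (\<Sum>i\<in>insert i T'. p ^ card (S i)) +
      (\<Sum>i\<in>insert i T'. \<Sum>j\<in>nbrs S (T \<union> T') i. ?f i j))"
    using insert by (simp add: exp_add[symmetric] mult.assoc)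
  also have "\<dots> \<le> avoid X p S T * exp (- (\<Sum>i\<in>insert i T'. p ^ card (S i)) +
      (\<Sum>i\<in>insert i T'. \<Sum>j\<in>nbrs S ?I i. ?f i j))"
  proof -
    have "(\<Sum>i\<in>insert i T'. \<Sum>j\<in>nbrs S (T \<union> T') i. ?f i j) \<le>
       (\<Sum>i\<in>insert i T'. \<Sum>j\<in>nbrs S ?I i. ?f i j)"
      using insert p by (intro sum_mono sum_mono2 nbrs_mono) auto
    then show ?thesis by (intro mult_left_mono avoid_nonneg) auto
  qed
  finally show ?case .
qed

end

subsection \<open>Clusters and symmetry\<close>

lemma sum_nested3: "(\<Sum>i\<in>A. \<Sum>j\<in>B. \<Sum>k\<in>C. f i j k) = (\<Sum>(i, j, k)\<in>A \<times> B \<times> C. f i j k)"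
  by (simp only: sum.cartesian_product)

lemma sum_nested4:
  "(\<Sum>i\<in>A. \<Sum>j\<in>B. \<Sum>k\<in>C. \<Sum>l\<in>D. f i j k l) = (\<Sum>(i, j, k, l)\<in>A \<times> B \<times> C \<times> D. f i j k l)"
  by (simp only: sum.cartesian_product)

text \<open>A form of 3-cluster without transitive closure: a connected graph on three vertices has
  a vertex adjacent to both others.\<close>

definition linked3 :: "(nat \<Rightarrow> 'a set) \<Rightarrow> nat \<Rightarrow> nat \<Rightarrow> nat \<Rightarrow> bool" where
  "linked3 E i j k \<longleftrightarrow> i \<noteq> j \<and> j \<noteq> k \<and> i \<noteq> k \<and>
     (adj E i j \<and> adj E i k \<or> adj E j i \<and> adj E j k \<or> adj E k i \<and> adj E k j)"

definition path4 :: "(nat \<Rightarrow> 'a set) \<Rightarrow> nat \<Rightarrow> nat \<Rightarrow> nat \<Rightarrow> nat \<Rightarrow> bool" where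
  "path4 E i i' j' j \<longleftrightarrow> distinct [i, i', j', j] \<and>
     adj E i i' \<and> adj E i' j' \<and> adj E j' j \<and> \<not> adj E i' j \<and> \<not> adj E i j'"

text \<open>Any two of the three indices are joined by a walk through the centre
  \<open>c\<close>.\<close>

lemma cluster3_center:
  assumes "{a, b, c} \<subseteq> {1..N}" "distinct [a, b, c]" "adj E c a" "adj E c b"
  shows "cluster N E 3 {a, b, c}"
proof -
  let ?S = "{a, b, c}"
  let ?r = "{(x, y). x \<in> ?S \<and> y \<in> ?S \<and> adj E x y}"
  have to_c: "(x, c) \<in> ?r\<^sup>*" if "x \<in> ?S" for x
    using that assms by (auto simp: adj_sym[of E _ c])
  have from_c: "(c, y) \<in> ?r\<^sup>*" if "y \<in> ?S" for y
    using that assms by auto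
  have "\<forall>x\<in>?S. \<forall>y\<in>?S. (x, y) \<in> ?r\<^sup>*"
    by (intro ballI rtrancl_trans[OF to_c from_c])
  moreover have "card ?S = 3" using assms by auto
  ultimately show ?thesis unfolding cluster_def using assms(1) by blast
qed

lemma linked3_cluster:
  assumes "{i, j, k} \<subseteq> {1..N}" "linked3 E i j k"
  shows "cluster N E 3 {i, j, k}"
proof -
  consider "adj E i j" "adj E i k" | "adj E j i" "adj E j k" | "adj E k i" "adj E k j"
    using assms(2) by (auto simp: linked3_def)
  then show ?thesis
  proof cases
    case 1
    then have "cluster N E 3 {j, k, i}" using assms by (intro cluster3_center) (auto simp: linked3_def)
    then show ?thesis by (simp add: insert_commute)
  next
    case 2
    then have "cluster N E 3 {i, k, j}" using assms by (intro cluster3_center) (auto simp: linked3_def)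
    then show ?thesis by (simp add: insert_commute)
  next
    case 3
    then show ?thesis using assms by (intro cluster3_center) (auto simp: linked3_def)
  qed
qed

lemma cluster2_iff: "cluster N E 2 S \<longleftrightarrow> (\<exists>i\<in>{1..N}. \<exists>j\<in>{1..N}. adj E i j \<and> S = {i, j})"
proof
  assume S: "cluster N E 2 S"
  then have "card S = 2" "S \<subseteq> {1..N}" by (auto simp: cluster_def)
  then obtain i j where ij: "S = {i, j}" "i \<noteq> j" by (auto simp: card_2_iff)
  have "adj E i j"
  proof (rule ccontr)
    assume *: "\<not> adj E i j"
    then have "\<not> adj E j i" by (simp add: adj_sym)
    then have r: "{(a, b). a \<in> S \<and> b \<in> S \<and> adj E a b} = {}"
      using * ij by (auto simp: adj_def)
    have "(i, j) \<in> {(a, b). a \<in> S \<and> b \<in> S \<and> adj E a b}\<^sup>*"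
      using S ij(1) unfolding cluster_def by blast
    then show False using ij(2) unfolding r by simp
  qed
  then show "\<exists>i\<in>{1..N}. \<exists>j\<in>{1..N}. adj E i j \<and> S = {i, j}"
    using ij \<open>S \<subseteq> _\<close> by blast
next
  assume "\<exists>i\<in>{1..N}. \<exists>j\<in>{1..N}. adj E i j \<and> S = {i, j}"
  then obtain i j where ij: "i \<in> {1..N}" "j \<in> {1..N}" "adj E i j" "S = {i, j}" by blast
  moreover have "i \<noteq> j" using ij by (auto simp: adj_def)
  moreover have "adj E j i" using ij by (simp add: adj_sym)
  ultimately show "cluster N E 2 S" by (auto simp: cluster_def)
qed

lemma finite_clusters: "finite {S. cluster N E k S}"
  by (rule finite_subset[of _ "Pow {1..N}"]) (auto simp: cluster_def)

section \<open>A fixed hypergraph: powers of \<open>p\<close>, cluster counts and symmetry\<close>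

locale hypergraph_model =
  fixes X :: "'a set" and N :: nat and E :: "nat \<Rightarrow> 'a set" and s :: nat and p :: real
  assumes uniform: "uniform_hypergraph X N E s" and p_pos: "0 < p" and p_less: "p < 1"
begin

abbreviation "V \<equiv> {1..N}"

lemma finX: "finite X" and inj_E: "inj_on E V"
  and E_sub: "i \<in> V \<Longrightarrow> E i \<subseteq> X" and card_E: "i \<in> V \<Longrightarrow> card (E i) = s"
  using uniform by (auto simp: uniform_hypergraph_def)

lemma finE: "i \<in> V \<Longrightarrow> finite (E i)"
  using E_sub finX finite_subset by blast

lemma p_bounds: "0 \<le> p" "p \<le> 1" "p \<noteq> 0"
  using p_pos p_less by auto

lemma R_sub: "Y \<subseteq> V \<Longrightarrow> R E Y \<subseteq> X"
  using E_sub by (fastforce simp: R_def)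

lemma pow_antimono: "m \<le> n \<Longrightarrow> p ^ n \<le> p ^ m"
  using p_bounds by (simp add: power_decreasing)

lemma pow_Un_eq:
  assumes "finite A" "finite B"
  shows "p ^ card (A \<union> B) = p ^ card A * p ^ card (B - A)"
proof -
  have "card (A \<union> B) = card A + card (B - A)"
    using assms card_Un_disjoint[of A "B - A"] by auto
  then show ?thesis by (simp add: power_add)
qed

lemma pow_Un_ge:
  assumes "finite A" "finite B"
  shows "p ^ card A * p ^ card B \<le> p ^ card (A \<union> B)"
  unfolding pow_Un_eq[OF assms] using assms p_bounds
  by (intro mult_left_mono pow_antimono card_mono) auto

text \<open>All edges of \<open>S\<close> are contained in \<open>W\<close> iff their union is; the
  rest is linearity of expectation.\<close>

lemma Delta_eq: "Delta X N E p k = (\<Sum>S | cluster N E k S. p ^ card (R E S))"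
proof -
  have "Delta X N E p k = rexp X p (\<lambda>W. \<Sum>S | cluster N E k S. of_bool (R E S \<subseteq> W))"
    unfolding Delta_def
  proof (rule rexp_cong[OF finX])
    fix W
    have "{S. cluster N E k S \<and> S \<subseteq> contained_edges N E W} = {S. cluster N E k S} \<inter> {S. R E S \<subseteq> W}"
      by (auto simp: cluster_def contained_edges_def R_def)
    then show "real (card {S. cluster N E k S \<and> S \<subseteq> contained_edges N E W}) =
       (\<Sum>S | cluster N E k S. of_bool (R E S \<subseteq> W))"
      using finite_clusters[of N E k] by simp
  qed
  also have "\<dots> = (\<Sum>S | cluster N E k S. p ^ card (R E S))"
    unfolding rexp_sum[OF finX]
    using p_bounds by (intro sum.cong refl rexp_superset finX R_sub) (auto simp: cluster_def)
  finally show ?thesis .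
qed

lemma Delta_nonneg: "0 \<le> Delta X N E p k"
  unfolding Delta_eq using p_bounds by (intro sum_nonneg) auto

text \<open>Grouping ordered pairs by their underlying set, each 2-cluster arises from exactly two
  of them.\<close>

lemma sum_pairs_eq: "(\<Sum>i\<in>V. \<Sum>j\<in>nbrs E V i. p ^ card (E i \<union> E j)) = 2 * Delta X N E p 2"
proof -
  let ?P = "Sigma V (nbrs E V)"
  let ?g = "\<lambda>(i, j). {i, j} :: nat set"
  have "(\<Sum>i\<in>V. \<Sum>j\<in>nbrs E V i. p ^ card (E i \<union> E j)) = (\<Sum>x\<in>?P. p ^ card (R E (?g x)))"
    by (simp add: sum.Sigma R_def split_def)
  also have "\<dots> = (\<Sum>S | cluster N E 2 S. \<Sum>x\<in>{x\<in>?P. ?g x = S}. p ^ card (R E (?g x)))"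
  proof (intro sum.group[symmetric] finite_clusters)
    show "?g ` ?P \<subseteq> {S. cluster N E 2 S}"
      unfolding cluster2_iff nbrs_def by blast
  qed simp
  also have "\<dots> = (\<Sum>S | cluster N E 2 S. 2 * p ^ card (R E S))"
  proof (rule sum.cong[OF refl])
    fix S assume "S \<in> {S. cluster N E 2 S}"
    then obtain i j where ij: "i \<in> V" "j \<in> V" "adj E i j" "S = {i, j}" by (auto simp: cluster2_iff)
    then have "i \<noteq> j" by (auto simp: adj_def)
    have "{x\<in>?P. ?g x = S} = {(i, j), (j, i)}"
    proof (rule set_eqI, clarify)
      fix a b
      show "(a, b) \<in> {x\<in>?P. ?g x = S} \<longleftrightarrow> (a, b) \<in> {(i, j), (j, i)}"
        unfolding ij(4) nbrs_def mem_Collect_eq mem_Sigma_iff prod.case doubleton_eq_iff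
        using ij(1-3) adj_sym[of E i j] by blast
    qed
    then have "(\<Sum>x\<in>{x\<in>?P. ?g x = S}. p ^ card (R E (?g x))) = (\<Sum>x\<in>{(i, j), (j, i)}. p ^ card (R E (?g x)))"
      by simp
    also have "\<dots> = 2 * p ^ card (R E S)"
      using \<open>i \<noteq> j\<close> ij by (simp add: insert_commute)
    finally show "(\<Sum>x\<in>{x\<in>?P. ?g x = S}. p ^ card (R E (?g x))) = 2 * p ^ card (R E S)" .
  qed
  finally show ?thesis by (simp add: Delta_eq sum_distrib_left)
qed

text \<open>
  Each 3-cluster through \<open>i\<close> is counted twice, so summing over \<open>i\<close> gives at most \<open>6 Delta3\<close>.
\<close>

definition T3 :: "nat \<Rightarrow> real" where
  "T3 i = (\<Sum>j\<in>V. \<Sum>k\<in>V. of_bool (linked3 E i j k) * p ^ card (E i \<union> E j \<union> E k))"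

lemma sum_T3_le: "(\<Sum>i\<in>V. T3 i) \<le> 6 * Delta X N E p 3"
proof -
  let ?P = "{x\<in>V \<times> V \<times> V. case x of (i, j, k) \<Rightarrow> linked3 E i j k}"
  let ?g = "\<lambda>(i, j, k). {i, j, k} :: nat set"
  have "(\<Sum>i\<in>V. T3 i) = (\<Sum>x\<in>V \<times> V \<times> V. (case x of (i, j, k) \<Rightarrow> of_bool (linked3 E i j k)) * p ^ card (R E (?g x)))"
    unfolding T3_def sum_nested3 by (intro sum.cong refl) (auto simp: R_def Un_assoc)
  also have "\<dots> = (\<Sum>x\<in>?P. p ^ card (R E (?g x)))"
    by (intro sum.mono_neutral_cong_right) auto
  also have "\<dots> = (\<Sum>S | cluster N E 3 S. \<Sum>x\<in>{x\<in>?P. ?g x = S}. p ^ card (R E (?g x)))"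
    by (intro sum.group[symmetric] finite_clusters) (auto intro!: linked3_cluster)
  also have "\<dots> \<le> (\<Sum>S | cluster N E 3 S. 6 * p ^ card (R E S))"
  proof (rule sum_mono)
    fix S assume "S \<in> {S. cluster N E 3 S}"
    then have "card S = 3" by (simp add: cluster_def)
    then obtain a b c where S: "S = {a, b, c}" by (auto simp: card_3_iff)
    let ?L = "[(a,b,c), (a,c,b), (b,a,c), (b,c,a), (c,a,b), (c,b,a)]"
    have "{x\<in>?P. ?g x = S} \<subseteq> set ?L"
    proof
      fix x assume x: "x \<in> {x\<in>?P. ?g x = S}"
      then obtain i j k where ijk: "x = (i, j, k)" "i \<noteq> j" "j \<noteq> k" "i \<noteq> k" "{i, j, k} = {a, b, c}"
        unfolding S by (auto simp: linked3_def)
      have "i \<in> {a, b, c}" "j \<in> {a, b, c}" "k \<in> {a, b, c}" using ijk(5) by blast+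
      then show "x \<in> set ?L" using ijk(1-4) by auto
    qed
    then have "card {x\<in>?P. ?g x = S} \<le> card (set ?L)"
      by (intro card_mono) auto
    also have "\<dots> \<le> length ?L" by (rule card_length)
    finally have c: "real (card {x\<in>?P. ?g x = S}) \<le> 6" by simp
    have "(\<Sum>x\<in>{x\<in>?P. ?g x = S}. p ^ card (R E (?g x))) = (\<Sum>x\<in>{x\<in>?P. ?g x = S}. p ^ card (R E S))"
      by (rule sum.cong) auto
    also have "\<dots> \<le> 6 * p ^ card (R E S)"
      using c p_bounds by (simp add: mult_right_mono)
    finally show "(\<Sum>x\<in>{x\<in>?P. ?g x = S}. p ^ card (R E (?g x))) \<le> 6 * p ^ card (R E S)" .
  qed
  finally show ?thesis by (simp add: Delta_eq sum_distrib_left)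
qed

text \<open>The share of \<open>i\<close> in \<open>2 * (Delta2 - Delta2_0)\<close>. Divided by
  \<open>p ^ s\<close>, it is the sum of \<open>P(A_j | A_i) - \<pi>\<close> over the neighbours
  \<open>j\<close> of \<open>i\<close>.\<close>

definition excess :: "nat \<Rightarrow> real" where
  "excess i = (\<Sum>j\<in>nbrs E V i. p ^ card (E i \<union> E j) - p ^ s * p ^ s)"

lemma Delta2_0_eq: "Delta2_0 X N E p = 1/2 * (\<Sum>i\<in>V. \<Sum>j\<in>nbrs E V i. p ^ s * p ^ s)"
proof -
  have "{(i, j). i \<in> V \<and> j \<in> V \<and> adj E i j} = Sigma V (nbrs E V)"
    by (auto simp: nbrs_def)
  moreover have "(\<Sum>(i, j)\<in>Sigma V (nbrs E V).
     \<P>(W in random_subset X p. E i \<subseteq> W) * \<P>(W in random_subset X p. E j \<subseteq> W)) =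
     (\<Sum>(i, j)\<in>Sigma V (nbrs E V). p ^ s * p ^ s)"
    using prob_superset[OF finX p_bounds(1,2) E_sub]
    by (intro sum.cong) (auto simp: nbrs_def card_E)
  ultimately show ?thesis
    unfolding Delta2_0_def by (subst sum.Sigma) simp_all
qed

lemma sum_excess: "(\<Sum>i\<in>V. excess i) = 2 * (Delta X N E p 2 - Delta2_0 X N E p)"
  using sum_pairs_eq by (simp add: excess_def sum_subtractf Delta2_0_eq)

lemma pair_ge: "i \<in> V \<Longrightarrow> j \<in> V \<Longrightarrow> p ^ s * p ^ s \<le> p ^ card (E i \<union> E j)"
  using pow_Un_ge[of "E i" "E j"] by (simp add: finE card_E)

text \<open>An automorphism permutes the edges as sets; since \<open>E\<close> is injective on
  \<open>V\<close>, this lifts to a permutation \<open>\<tau>\<close> of the indices.\<close>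

lemma index_permutation:
  assumes "symmetric_hypergraph X N E" "y \<in> V" "y' \<in> V"
  obtains \<tau> \<sigma> where "bij_betw \<tau> V V" "\<tau> y = y'" "inj_on \<sigma> X" "\<And>i. i \<in> V \<Longrightarrow> E (\<tau> i) = \<sigma> ` E i"
proof -
  obtain \<sigma> where \<sigma>: "hypergraph_automorphism X N E \<sigma>" "\<sigma> ` E y = E y'"
    using assms unfolding symmetric_hypergraph_def by blast
  have inj: "inj_on \<sigma> X" and im: "(`) \<sigma> ` (E ` V) = E ` V"
    using \<sigma>(1) by (auto simp: hypergraph_automorphism_def bij_betw_def)
  have "inj_on ((`) \<sigma>) (E ` V)"
    by (rule inj_on_subset[OF inj_on_image_Pow[OF inj]]) (use E_sub in blast)
  then have b2: "bij_betw ((`) \<sigma>) (E ` V) (E ` V)" using im by (simp add: bij_betw_def)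
  have b1: "bij_betw E V (E ` V)" using inj_E by (simp add: bij_betw_def)
  define \<tau> where "\<tau> = the_inv_into V E \<circ> ((`) \<sigma> \<circ> E)"
  have bij: "bij_betw \<tau> V V"
    unfolding \<tau>_def by (intro bij_betw_trans[OF bij_betw_trans[OF b1 b2]] bij_betw_the_inv_into b1)
  have E\<tau>: "E (\<tau> i) = \<sigma> ` E i" if "i \<in> V" for i
  proof -
    have "\<sigma> ` E i \<in> E ` V" using im that by blast
    then show ?thesis unfolding \<tau>_def o_apply by (rule f_the_inv_into_f[OF inj_E])
  qed
  have "\<tau> y \<in> V" using bij assms by (auto simp: bij_betw_def)
  moreover have "E (\<tau> y) = E y'" using E\<tau> \<sigma> assms by simp
  ultimately have "\<tau> y = y'" using inj_onD[OF inj_E _ _ assms(3)] by blast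
  then show ?thesis using that bij inj E\<tau> by blast
qed

text \<open>The automorphism preserves intersections and the sizes of unions, so reindexing the sums
  by \<open>\<tau>\<close> carries those at \<open>y'\<close> to those at \<open>y\<close>.\<close>

lemma symmetric_sums:
  assumes "symmetric_hypergraph X N E" "y \<in> V" "y' \<in> V"
  shows "T3 y' = T3 y" "excess y' = excess y"
proof -
  obtain \<tau> \<sigma> where bij: "bij_betw \<tau> V V" and y: "\<tau> y = y'" and inj: "inj_on \<sigma> X"
    and E\<tau>: "\<And>i. i \<in> V \<Longrightarrow> E (\<tau> i) = \<sigma> ` E i"
    using index_permutation[OF assms] by blast
  have \<tau>_eq: "\<tau> i = \<tau> j \<longleftrightarrow> i = j" if "i \<in> V" "j \<in> V" for i j
    using inj_on_eq_iff[OF bij_betw_imp_inj_on[OF bij]] that by blast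
  have adj: "adj E (\<tau> i) (\<tau> j) \<longleftrightarrow> adj E i j" if "i \<in> V" "j \<in> V" for i j
  proof -
    have "\<sigma> ` E i \<inter> \<sigma> ` E j = \<sigma> ` (E i \<inter> E j)"
      using inj_on_image_Int[OF inj E_sub E_sub] that by simp
    then show ?thesis using that by (simp add: adj_def E\<tau> \<tau>_eq)
  qed
  have linked: "linked3 E (\<tau> i) (\<tau> j) (\<tau> k) \<longleftrightarrow> linked3 E i j k" if "i \<in> V" "j \<in> V" "k \<in> V" for i j k
    using that by (simp add: linked3_def adj \<tau>_eq)
  have card: "card (\<sigma> ` A) = card A" if "A \<subseteq> X" for A
    using inj that by (meson card_image inj_on_subset)
  have reindex: "(\<Sum>j\<in>V. f j) = (\<Sum>j\<in>V. f (\<tau> j))" for f :: "nat \<Rightarrow> real"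
    by (rule sum.reindex_bij_betw[OF bij, symmetric])
  have reindex2: "(\<Sum>j\<in>V. \<Sum>k\<in>V. f j k) = (\<Sum>j\<in>V. \<Sum>k\<in>V. f (\<tau> j) (\<tau> k))" for f :: "nat \<Rightarrow> nat \<Rightarrow> real"
    by (rule trans[OF reindex sum.cong[OF refl reindex]])
  have "T3 y' = (\<Sum>j\<in>V. \<Sum>k\<in>V. of_bool (linked3 E y' (\<tau> j) (\<tau> k)) * p ^ card (E y' \<union> E (\<tau> j) \<union> E (\<tau> k)))"
    unfolding T3_def by (rule reindex2)
  also have "\<dots> = T3 y"
    unfolding T3_def
  proof (intro sum.cong refl)
    fix j k assume jk: "j \<in> V" "k \<in> V"
    have "card (E y' \<union> E (\<tau> j) \<union> E (\<tau> k)) = card (\<sigma> ` (E y \<union> E j \<union> E k))"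
      using jk assms by (simp add: y[symmetric] E\<tau> image_Un)
    also have "\<dots> = card (E y \<union> E j \<union> E k)"
      using E_sub jk assms by (intro card) auto
    finally show "of_bool (linked3 E y' (\<tau> j) (\<tau> k)) * p ^ card (E y' \<union> E (\<tau> j) \<union> E (\<tau> k)) =
       of_bool (linked3 E y j k) * p ^ card (E y \<union> E j \<union> E k)"
      using linked[of y j k] jk assms y by simp
  qed
  finally show "T3 y' = T3 y" .
  have ex: "excess i = (\<Sum>j\<in>V. of_bool (adj E i j) * (p ^ card (E i \<union> E j) - p ^ s * p ^ s))" for i
    unfolding excess_def nbrs_def by (intro sum.mono_neutral_cong_left) auto
  have "excess y' = (\<Sum>j\<in>V. of_bool (adj E y' (\<tau> j)) * (p ^ card (E y' \<union> E (\<tau> j)) - p ^ s * p ^ s))"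
    unfolding ex by (rule reindex)
  also have "\<dots> = excess y"
    unfolding ex
  proof (intro sum.cong refl)
    fix j assume j: "j \<in> V"
    have "card (E y' \<union> E (\<tau> j)) = card (\<sigma> ` (E y \<union> E j))"
      using j assms by (simp add: y[symmetric] E\<tau> image_Un)
    also have "\<dots> = card (E y \<union> E j)"
      using E_sub j assms by (intro card) auto
    finally show "of_bool (adj E y' (\<tau> j)) * (p ^ card (E y' \<union> E (\<tau> j)) - p ^ s * p ^ s) =
       of_bool (adj E y j) * (p ^ card (E y \<union> E j) - p ^ s * p ^ s)"
      using adj[of y j] j assms y by simp
  qed
  finally show "excess y' = excess y" .
qed

text \<open>By symmetry all indices contribute equally to the total, so each contribution is the
  average; multiplying by \<open>N\<close> avoids a division.\<close>

lemma symmetric_averages: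
  assumes "symmetric_hypergraph X N E" "y \<in> V"
  shows "real N * T3 y \<le> 6 * Delta X N E p 3"
    and "real N * excess y = 2 * (Delta X N E p 2 - Delta2_0 X N E p)"
proof -
  have "(\<Sum>i\<in>V. T3 i) = (\<Sum>i\<in>V. T3 y)"
    using symmetric_sums(1)[OF assms] by (intro sum.cong) auto
  then show "real N * T3 y \<le> 6 * Delta X N E p 3" using sum_T3_le by simp
  have "(\<Sum>i\<in>V. excess i) = (\<Sum>i\<in>V. excess y)"
    using symmetric_sums(2)[OF assms] by (intro sum.cong) auto
  then show "real N * excess y = 2 * (Delta X N E p 2 - Delta2_0 X N E p)" using sum_excess by simp
qed

section \<open>Relating \<phi>, \<open>Q2\<close>, \<open>Q3\<close> and \<open>Q4\<close> to powers
  of \<open>p\<close>\<close>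

lemma finite_phi_set:
  "finite {\<P>(W in random_subset X p. E i \<subseteq> W \<bar> E j \<subseteq> W) | i j. i \<in> V \<and> j \<in> V \<and> i \<noteq> j}"
proof (rule finite_subset)
  show "{\<P>(W in random_subset X p. E i \<subseteq> W \<bar> E j \<subseteq> W) | i j. i \<in> V \<and> j \<in> V \<and> i \<noteq> j} \<subseteq>
    (\<lambda>(i, j). \<P>(W in random_subset X p. E i \<subseteq> W \<bar> E j \<subseteq> W)) ` (V \<times> V)"
    by auto
qed simp

lemma phi_ge:
  assumes "i \<in> V" "j \<in> V" "i \<noteq> j"
  shows "p ^ card (E i - E j) \<le> phi X N E p"
proof -
  have "\<P>(W in random_subset X p. E i \<subseteq> W \<bar> E j \<subseteq> W) \<le> phi X N E p"
    unfolding phi_def using assms finite_phi_set by (intro Max_ge) auto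
  then show ?thesis
    using cond_prob_superset[OF finX p_pos p_bounds(2) E_sub E_sub] assms by simp
qed

lemma phi_nonneg: "0 \<le> phi X N E p"
  unfolding phi_def using finite_phi_set by (intro Max_ge) auto

text \<open>Conditioning on another edge can only raise the probability of \<open>A_i\<close>. The
  second index excludes the fallback value 0 of the maximum.\<close>

lemma pi_le_phi:
  assumes "i \<in> V" "j \<in> V" "i \<noteq> j"
  shows "p ^ s \<le> phi X N E p"
proof -
  have "p ^ s \<le> p ^ card (E i - E j)"
    using assms card_mono[of "E i" "E i - E j"] by (intro pow_antimono) (auto simp: finE card_E)
  then show ?thesis using phi_ge[OF assms] by linarith
qed

lemma Q2_eq:
  assumes "Y \<subseteq> V"
  shows "Q2 N E Y = 1/2 * (\<Sum>i\<in>Y. real (card (nbrs E Y i)))"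
proof -
  have "(\<Sum>(i, j) \<in> {(i, j). i \<in> V \<and> j \<in> V \<and> adj E i j}. of_bool (i \<in> Y \<and> j \<in> Y)) =
        (\<Sum>(i, j) \<in> Sigma Y (nbrs E Y). 1 :: real)"
  proof (rule sum.mono_neutral_cong_right)
    show "finite {(i, j). i \<in> V \<and> j \<in> V \<and> adj E i j}"
      by (rule finite_subset[of _ "V \<times> V"]) auto
  qed (use assms in \<open>auto simp: nbrs_def\<close>)
  also have "\<dots> = (\<Sum>i\<in>Y. real (card (nbrs E Y i)))"
    using assms finite_subset[OF assms] by (subst sum.Sigma[symmetric]) (auto simp: nbrs_def)
  finally show ?thesis by (simp add: Q2_def)
qed

lemma Q3_ge:
  assumes "Y \<subseteq> V"
  shows "(\<Sum>i\<in>Y. \<Sum>j\<in>Y. \<Sum>k\<in>V. of_bool (linked3 E i j k) * p ^ card (E k - E i)) \<le> Q3 X N E p Y"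
proof -
  let ?P = "{(i, j, k). distinct [i, j, k] \<and> cluster N E 3 {i, j, k}}"
  let ?f = "\<lambda>(i, j, k). of_bool (i \<in> Y \<and> j \<in> Y) * \<P>(W in random_subset X p. E k \<subseteq> W \<bar> E i \<subseteq> W)"
  have fin: "finite ?P" by (rule finite_subset[of _ "V \<times> V \<times> V"]) (auto simp: cluster_def)
  have finY: "finite Y" using assms finite_subset by blast
  have "(\<Sum>i\<in>Y. \<Sum>j\<in>Y. \<Sum>k\<in>V. of_bool (linked3 E i j k) * p ^ card (E k - E i)) =
     (\<Sum>(i, j, k)\<in>Y \<times> Y \<times> V. of_bool (linked3 E i j k) * p ^ card (E k - E i))"
    by (rule sum_nested3)
  also have "\<dots> = (\<Sum>x\<in>{(i, j, k)\<in>Y \<times> Y \<times> V. linked3 E i j k}. ?f x)"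
  proof (rule sum.mono_neutral_cong_right)
    fix x assume "x \<in> {(i, j, k)\<in>Y \<times> Y \<times> V. linked3 E i j k}"
    then obtain i j k where x: "x = (i, j, k)" "i \<in> Y" "j \<in> Y" "k \<in> V" "linked3 E i j k" by auto
    then have "i \<in> V" using assms by auto
    then show "(case x of (i, j, k) \<Rightarrow> of_bool (linked3 E i j k) * p ^ card (E k - E i)) = ?f x"
      using x cond_prob_superset[OF finX p_pos p_bounds(2) E_sub E_sub, of k i] by simp
  qed (use finY in auto)
  also have "\<dots> \<le> (\<Sum>x\<in>?P. ?f x)"
  proof (rule sum_mono2[OF fin])
    show "{(i, j, k)\<in>Y \<times> Y \<times> V. linked3 E i j k} \<subseteq> ?P"
    proof (clarify, intro conjI)
      fix i j k assume *: "i \<in> Y" "j \<in> Y" "k \<in> V" "linked3 E i j k"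
      then show "distinct [i, j, k]" by (auto simp: linked3_def)
      show "cluster N E 3 {i, j, k}" using * assms by (intro linked3_cluster) auto
    qed
  qed (auto simp: cond_prob_def)
  finally show ?thesis by (simp add: Q3_def)
qed

lemma Q4_eq:
  assumes "Y \<subseteq> V"
  shows "(\<Sum>y\<in>Y. \<Sum>y'\<in>Y. \<Sum>i\<in>V. \<Sum>j\<in>V. of_bool (path4 E y i j y') * p ^ card (E i \<union> E j - (E y \<union> E y')))
     = Q4 X N E p Y"
proof -
  let ?P = "{(i, i', j', j). {i, i', j', j} \<subseteq> V \<and> distinct [i, i', j', j] \<and>
          adj E i i' \<and> adj E i' j' \<and> adj E j' j \<and> \<not> adj E i' j \<and> \<not> adj E i j'}"
  let ?f = "\<lambda>(i, i', j', j). of_bool (i \<in> Y \<and> j \<in> Y) *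
        \<P>(W in random_subset X p. E i' \<subseteq> W \<and> E j' \<subseteq> W \<bar> E i \<subseteq> W \<and> E j \<subseteq> W)"
  let ?B = "{(i, i', j', j)\<in>Y \<times> V \<times> V \<times> Y. path4 E i i' j' j}"
  have fin: "finite ?P" by (rule finite_subset[of _ "V \<times> V \<times> V \<times> V"]) auto
  have finY: "finite Y" using assms finite_subset by blast
  have "(\<Sum>y\<in>Y. \<Sum>y'\<in>Y. \<Sum>i\<in>V. \<Sum>j\<in>V. of_bool (path4 E y i j y') * p ^ card (E i \<union> E j - (E y \<union> E y'))) =
     (\<Sum>y\<in>Y. \<Sum>i\<in>V. \<Sum>j\<in>V. \<Sum>y'\<in>Y. of_bool (path4 E y i j y') * p ^ card (E i \<union> E j - (E y \<union> E y')))"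
    by (rule sum.cong[OF refl], rule trans[OF sum.swap], rule sum.cong[OF refl], rule sum.swap)
  also have "\<dots> = (\<Sum>(y, i, j, y')\<in>Y \<times> V \<times> V \<times> Y. of_bool (path4 E y i j y') * p ^ card (E i \<union> E j - (E y \<union> E y')))"
    by (rule sum_nested4)
  also have "\<dots> = (\<Sum>x\<in>?B. ?f x)"
  proof (rule sum.mono_neutral_cong_right)
    fix x assume "x \<in> ?B"
    then obtain y i j y' where x: "x = (y, i, j, y')" "y \<in> Y" "i \<in> V" "j \<in> V" "y' \<in> Y" "path4 E y i j y'" by auto
    then have "y \<in> V" "y' \<in> V" using assms by auto
    then have "E i \<union> E j \<subseteq> X" "E y \<union> E y' \<subseteq> X" using x E_sub by auto
    then show "(case x of (y, i, j, y') \<Rightarrow> of_bool (path4 E y i j y') * p ^ card (E i \<union> E j - (E y \<union> E y'))) = ?f x"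
      using x cond_prob_superset[OF finX p_pos p_bounds(2), of "E i \<union> E j" "E y \<union> E y'"] by simp
  qed (use finY in auto)
  also have "\<dots> = (\<Sum>x\<in>?P. ?f x)"
    using fin assms by (intro sum.mono_neutral_left) (auto simp: path4_def)
  finally show ?thesis by (simp add: Q4_def)
qed

lemma Q_nonneg: "0 \<le> Q2 N E Y" "0 \<le> Q3 X N E p Y" "0 \<le> Q4 X N E p Y"
  unfolding Q2_def Q3_def Q4_def cond_prob_def by (auto intro!: sum_nonneg)

end

subsection \<open>Conditioning on the edges of \<open>Y\<close>\<close>

context hypergraph_model
begin

lemma pairs_term_nonneg: "j \<in> nbrs E V i \<Longrightarrow> i \<in> V \<Longrightarrow> 0 \<le> p ^ card (E i \<union> E j) - p ^ s * p ^ s"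
  using pair_ge[of i j] by (simp add: nbrs_def)

lemma T3_nonneg: "0 \<le> T3 i"
  unfolding T3_def using p_bounds by (intro sum_nonneg) auto

text \<open>Common last step for error sums whose index pairs form 3-clusters with a fixed
  \<open>i\<close>.\<close>

lemma sum_le_T3:
  assumes "J \<subseteq> V" "\<And>j. j \<in> J \<Longrightarrow> K j \<subseteq> V"
    and "\<And>j k. j \<in> J \<Longrightarrow> k \<in> K j \<Longrightarrow> linked3 E i j k \<and> f j k \<le> p ^ card (E i \<union> E j \<union> E k)"
  shows "(\<Sum>j\<in>J. \<Sum>k\<in>K j. f j k) \<le> T3 i"
proof -
  let ?g = "\<lambda>j k. of_bool (linked3 E i j k) * p ^ card (E i \<union> E j \<union> E k)"
  have "(\<Sum>j\<in>J. \<Sum>k\<in>K j. f j k) \<le> (\<Sum>j\<in>J. \<Sum>k\<in>K j. ?g j k)"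
    using assms(3) by (intro sum_mono) simp
  also have "\<dots> \<le> (\<Sum>j\<in>J. \<Sum>k\<in>V. ?g j k)"
    using assms p_bounds by (intro sum_mono sum_mono2) auto
  also have "\<dots> \<le> T3 i"
    unfolding T3_def using assms p_bounds by (intro sum_mono2 sum_nonneg) auto
  finally show ?thesis .
qed

text \<open>In the product of sums, the diagonal gives the \<phi> term, since \<pi> is at most
  \<phi>, and the other pairs form 3-clusters centred at \<open>i\<close>. In the second part,
  \<open>j\<close> is adjacent to \<open>i\<close> and \<open>k\<close> to one of them, again a
  3-cluster.\<close>

lemma janson_error_le:
  assumes i: "i \<in> V"
  shows "janson_error p E V i \<le> phi X N E p * (\<Sum>j\<in>nbrs E V i. p ^ card (E i \<union> E j)) + 2 * T3 i"
proof -
  define J where "J = nbrs E V i"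
  have J: "J \<subseteq> V" "finite J" by (auto simp: J_def nbrs_def)
  have J_adj: "j \<in> V" "adj E i j" "i \<noteq> j" if "j \<in> J" for j
    using that by (auto simp: J_def nbrs_def adj_def)
  let ?P = "\<lambda>j. p ^ card (E i \<union> E j)"
  have "(\<Sum>j\<in>J. ?P j) * (\<Sum>k\<in>J. p ^ card (E k)) = (\<Sum>j\<in>J. \<Sum>k\<in>J. ?P j * p ^ card (E k))"
    by (rule sum_product)
  also have "\<dots> = (\<Sum>j\<in>J. ?P j * p ^ card (E j)) + (\<Sum>j\<in>J. \<Sum>k\<in>J - {j}. ?P j * p ^ card (E k))"
    unfolding sum.distrib[symmetric]
    by (rule sum.cong[OF refl], rule sum.remove) (use J in auto)
  also have "\<dots> \<le> (\<Sum>j\<in>J. phi X N E p * ?P j) + T3 i"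
  proof (rule add_mono)
    show "(\<Sum>j\<in>J. ?P j * p ^ card (E j)) \<le> (\<Sum>j\<in>J. phi X N E p * ?P j)"
    proof (rule sum_mono)
      fix j assume "j \<in> J"
      then have "p ^ card (E j) \<le> phi X N E p"
        using J_adj pi_le_phi[OF i] card_E by metis
      then show "?P j * p ^ card (E j) \<le> phi X N E p * ?P j"
        using p_bounds by (simp add: mult.commute mult_right_mono)
    qed
    show "(\<Sum>j\<in>J. \<Sum>k\<in>J - {j}. ?P j * p ^ card (E k)) \<le> T3 i"
    proof (rule sum_le_T3)
      fix j k assume "j \<in> J" "k \<in> J - {j}"
      then show "linked3 E i j k \<and> ?P j * p ^ card (E k) \<le> p ^ card (E i \<union> E j \<union> E k)"
        using J_adj[of j] J_adj[of k] pow_Un_ge[of "E i \<union> E j" "E k"] finE i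
        unfolding linked3_def by auto
    qed (use J in auto)
  qed
  finally have 1: "(\<Sum>j\<in>J. ?P j) * (\<Sum>k\<in>J. p ^ card (E k)) \<le> phi X N E p * (\<Sum>j\<in>J. ?P j) + T3 i"
    by (simp add: sum_distrib_left)
  let ?K = "\<lambda>j. {k\<in>V - {i, j}. adj E j k \<or> adj E i k}"
  have "p ^ card (E i) * (\<Sum>j\<in>J. \<Sum>k\<in>?K j. p ^ card (E j \<union> E k)) =
      (\<Sum>j\<in>J. \<Sum>k\<in>?K j. p ^ card (E i) * p ^ card (E j \<union> E k))"
    by (simp add: sum_distrib_left)
  also have "\<dots> \<le> T3 i"
  proof (rule sum_le_T3)
    fix j k assume jk: "j \<in> J" "k \<in> ?K j"
    then have "p ^ card (E i) * p ^ card (E j \<union> E k) \<le> p ^ card (E i \<union> (E j \<union> E k))"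
      using J_adj[of j] i by (intro pow_Un_ge) (auto simp: finE)
    moreover have "linked3 E i j k"
      using J_adj[of j] jk adj_sym[of E i j] unfolding linked3_def by blast
    ultimately show "linked3 E i j k \<and> p ^ card (E i) * p ^ card (E j \<union> E k) \<le> p ^ card (E i \<union> E j \<union> E k)"
      by (simp add: Un_assoc)
  qed (use J in auto)
  finally show ?thesis
    using 1 unfolding janson_error_def J_def by linarith
qed

text \<open>
  Edges outside \<open>Y\<close> with two or more neighbours in \<open>Y\<close> are dropped from the avoided family;
  this is harmless since \<open>p ^ s\<close> times their number is at most \<open>Q3\<close>.
\<close>

definition free :: "nat set \<Rightarrow> nat set" where
  "free Y = {i\<in>V - Y. nbrs E Y i = {}}"

definition touching :: "nat set \<Rightarrow> nat set" where
  "touching Y = {i\<in>V - Y. \<exists>y. nbrs E Y i = {y}}"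

text \<open>What must still be selected to complete edge \<open>i\<close> once all vertices of
  \<open>R E Y\<close> are present.\<close>

definition residual :: "nat set \<Rightarrow> nat \<Rightarrow> 'a set" where
  "residual Y i = E i - R E Y"

lemma residual_eq: "i \<in> V - Y \<Longrightarrow> residual Y i = E i - (\<Union>y\<in>nbrs E Y i. E y)"
  by (auto simp: residual_def R_def nbrs_def adj_def)

lemma free_touching: "free Y \<subseteq> V" "touching Y \<subseteq> V" "free Y \<inter> touching Y = {}"
    "finite (free Y)" "finite (touching Y)"
  by (auto simp: free_def touching_def)

lemma residual_sub: "i \<in> V \<Longrightarrow> residual Y i \<subseteq> X"
  using E_sub by (fastforce simp: residual_def)

text \<open>If \<open>I = Y\<close>, then \<open>R E Y\<close> is selected and no edge outside
  \<open>Y\<close> is completed. Residuals are disjoint from \<open>R E Y\<close>, so the two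
  requirements are independent; keeping only free and touching indices enlarges the event.\<close>

lemma prob_eq_le:
  assumes Y: "Y \<subseteq> V"
  shows "\<P>(W in random_subset X p. contained_edges N E W = Y) \<le>
    p ^ card (R E Y) * avoid X p (residual Y) (free Y \<union> touching Y)"
proof -
  let ?Z = "free Y \<union> touching Y"
  let ?g = "\<lambda>W. of_bool (\<forall>j\<in>?Z. \<not> residual Y j \<subseteq> W) :: real"
  have "\<P>(W in random_subset X p. contained_edges N E W = Y) =
      rexp X p (\<lambda>W. of_bool (contained_edges N E W = Y))"
    by (rule rexp_of_bool[OF finX, symmetric])
  also have "\<dots> \<le> rexp X p (\<lambda>W. of_bool (R E Y \<subseteq> W) * ?g W)"
  proof (rule rexp_mono[OF finX])
    fix W
    show "of_bool (contained_edges N E W = Y) \<le> of_bool (R E Y \<subseteq> W) * ?g W"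
    proof (cases "contained_edges N E W = Y")
      case True
      then have R: "R E Y \<subseteq> W" by (auto simp: R_def contained_edges_def)
      have "\<not> residual Y j \<subseteq> W" if "j \<in> ?Z" for j
      proof
        assume "residual Y j \<subseteq> W"
        then have "E j \<subseteq> W" using R by (auto simp: residual_def)
        then have "j \<in> contained_edges N E W" using that free_touching(1,2)[of Y] by (auto simp: contained_edges_def)
        then show False using that True by (auto simp: free_def touching_def)
      qed
      then show ?thesis using R by simp
    qed simp
  qed
  also have "\<dots> = p ^ card (R E Y) * rexp X p ?g"
  proof (rule rexp_superset_indep[OF finX p_bounds(1,2) R_sub[OF Y]])
    fix W
    have "residual Y j \<subseteq> W \<longleftrightarrow> residual Y j \<subseteq> W - R E Y" for j
      by (auto simp: residual_def)
    then show "?g W = ?g (W - R E Y)" by simp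
  qed
  finally show ?thesis by (simp add: avoid_def)
qed

text \<open>Free edges equal their residuals, so the refined Janson inequality applies to the
  original edges. The pair and error sums extend to all of \<open>V\<close> because their terms are
  nonnegative.\<close>

lemma avoid_free_le:
  "avoid X p (residual Y) (free Y) \<le> exp (- (\<Sum>i\<in>free Y. p ^ s) +
     (Delta X N E p 2 - Delta2_0 X N E p) + (2 * (phi X N E p * Delta X N E p 2) + 12 * Delta X N E p 3))"
proof -
  let ?F = "free Y"
  note F = free_touching[of Y]
  let ?f = "\<lambda>i j. p ^ card (E i \<union> E j) - p ^ s * p ^ s"
  have "residual Y i = E i" if "i \<in> ?F" for i
    using that residual_eq[of i Y] by (auto simp: free_def)
  then have "avoid X p (residual Y) ?F = avoid X p E ?F"
    by (simp add: avoid_def)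
  also have "\<dots> \<le> exp (- (\<Sum>i\<in>?F. p ^ card (E i)) +
    1/2 * (\<Sum>i\<in>?F. \<Sum>j\<in>nbrs E ?F i. p ^ card (E i \<union> E j) - p ^ card (E i) * p ^ card (E j)) +
    (\<Sum>i\<in>?F. janson_error p E ?F i))"
    using F by (intro refined_janson finX p_bounds E_sub) auto
  also have "(\<Sum>i\<in>?F. p ^ card (E i)) = (\<Sum>i\<in>?F. p ^ s)"
    using F card_E by (intro sum.cong) auto
  also have "(\<Sum>i\<in>?F. \<Sum>j\<in>nbrs E ?F i. p ^ card (E i \<union> E j) - p ^ card (E i) * p ^ card (E j)) =
      (\<Sum>i\<in>?F. \<Sum>j\<in>nbrs E ?F i. ?f i j)"
  proof (intro sum.cong refl)
    fix i j assume "i \<in> ?F" "j \<in> nbrs E ?F i"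
    then have "i \<in> V" "j \<in> V" using F by (auto simp: nbrs_def)
    then show "p ^ card (E i \<union> E j) - p ^ card (E i) * p ^ card (E j) = ?f i j"
      by (simp add: card_E)
  qed
  finally have *: "avoid X p (residual Y) ?F \<le> exp (- (\<Sum>i\<in>?F. p ^ s) +
    1/2 * (\<Sum>i\<in>?F. \<Sum>j\<in>nbrs E ?F i. ?f i j) + (\<Sum>i\<in>?F. janson_error p E ?F i))" .
  have "(\<Sum>i\<in>?F. \<Sum>j\<in>nbrs E ?F i. ?f i j) \<le> (\<Sum>i\<in>?F. excess i)"
    unfolding excess_def using F pairs_term_nonneg
    by (intro sum_mono sum_mono2 nbrs_mono) auto
  also have "\<dots> \<le> (\<Sum>i\<in>V. excess i)"
    using F by (intro sum_mono2) (auto simp only: excess_def intro!: sum_nonneg pairs_term_nonneg)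
  finally have 1: "1/2 * (\<Sum>i\<in>?F. \<Sum>j\<in>nbrs E ?F i. ?f i j) \<le> Delta X N E p 2 - Delta2_0 X N E p"
    using sum_excess by simp
  have "(\<Sum>i\<in>?F. janson_error p E ?F i) \<le>
     (\<Sum>i\<in>?F. phi X N E p * (\<Sum>j\<in>nbrs E V i. p ^ card (E i \<union> E j)) + 2 * T3 i)"
  proof (rule sum_mono)
    fix i assume "i \<in> ?F"
    then have "i \<in> V" using F by auto
    moreover have "janson_error p E ?F i \<le> janson_error p E V i"
      using F p_bounds by (intro janson_error_mono) auto
    ultimately show "janson_error p E ?F i \<le> phi X N E p * (\<Sum>j\<in>nbrs E V i. p ^ card (E i \<union> E j)) + 2 * T3 i"
      using janson_error_le by (meson order_trans)
  qed
  also have "\<dots> \<le> (\<Sum>i\<in>V. phi X N E p * (\<Sum>j\<in>nbrs E V i. p ^ card (E i \<union> E j)) + 2 * T3 i)"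
    using F p_bounds
    by (intro sum_mono2 add_nonneg_nonneg mult_nonneg_nonneg sum_nonneg phi_nonneg T3_nonneg) auto
  also have "\<dots> = phi X N E p * (2 * Delta X N E p 2) + 2 * (\<Sum>i\<in>V. T3 i)"
    by (simp only: sum.distrib sum_distrib_left[symmetric] sum_pairs_eq)
  also have "\<dots> \<le> 2 * (phi X N E p * Delta X N E p 2) + 12 * Delta X N E p 3"
    using sum_T3_le by simp
  finally have 2: "(\<Sum>i\<in>?F. janson_error p E ?F i) \<le> 2 * (phi X N E p * Delta X N E p 2) + 12 * Delta X N E p 3" .
  show ?thesis
    by (rule order_trans[OF *]) (use 1 2 in simp)
qed

text \<open>The edge \<open>i\<close> has a unique neighbour \<open>y\<close> in \<open>Y\<close>.
  If \<open>j\<close> has no other neighbour in \<open>Y\<close>, the left side is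
  \<open>P(A_i and A_j | A_y)\<close> for a 3-cluster; otherwise \<open>j\<close> has a different
  unique neighbour \<open>y'\<close>, and \<open>y, i, j, y'\<close> is a path counted by
  \<open>Q4\<close>.\<close>

lemma residual_pair_le:
  assumes Y: "Y \<subseteq> V" and i: "i \<in> touching Y"
    and j: "j \<in> nbrs (residual Y) (free Y \<union> touching Y) i"
  shows "p ^ card (residual Y i \<union> residual Y j) \<le>
    (\<Sum>y\<in>Y. of_bool (linked3 E y i j) * p ^ card (E y \<union> E i \<union> E j) / p ^ s) +
    (\<Sum>y\<in>Y. \<Sum>y'\<in>Y. of_bool (path4 E y i j y') * p ^ card (E i \<union> E j - (E y \<union> E y')))"
    (is "_ \<le> (\<Sum>y\<in>Y. ?A y) + (\<Sum>y\<in>Y. \<Sum>y'\<in>Y. ?B y y')")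
proof -
  have finY: "finite Y" using Y finite_subset by blast
  obtain y where y: "nbrs E Y i = {y}" using i by (auto simp: touching_def)
  have iV: "i \<in> V - Y" and jV: "j \<in> V - Y"
    using i j by (auto simp: touching_def free_def nbrs_def)
  have adj_ij: "adj E i j" using j by (auto simp: nbrs_def adj_def residual_def)
  have yY: "y \<in> Y" "adj E y i" "y \<in> V" using y Y adj_sym[of E i y] by (auto simp: nbrs_def)
  have nn: "0 \<le> ?A y" "0 \<le> ?B y y'" for y y' using p_bounds by auto
  consider "nbrs E Y j \<subseteq> {y}" | y' where "nbrs E Y j = {y'}" "y' \<noteq> y"
    using j by (auto simp: touching_def free_def nbrs_def[of "residual Y"])
  then show ?thesis
  proof cases
    case 1
    have "(E j \<inter> E y \<noteq> {}) \<longrightarrow> y \<in> nbrs E Y j" using yY jV by (auto simp: nbrs_def adj_def)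
    \<comment> \<open>If \<open>j\<close> is free, then \<open>E j\<close> is disjoint from
      \<open>E y\<close>, so removing \<open>E y\<close> from it changes nothing.\<close>
    then have eq: "residual Y i \<union> residual Y j = E i \<union> E j - E y"
      using 1 unfolding residual_eq[OF iV] residual_eq[OF jV] y by auto
    have "linked3 E y i j"
      using yY adj_ij iV jV adj_sym[of E y i] by (auto simp: linked3_def adj_def)
    moreover have "p ^ card (E y \<union> (E i \<union> E j)) = p ^ s * p ^ card (E i \<union> E j - E y)"
      using pow_Un_eq[of "E y" "E i \<union> E j"] finE iV jV yY by (simp add: card_E)
    ultimately have "p ^ card (residual Y i \<union> residual Y j) = ?A y"
      using p_bounds by (simp add: eq Un_assoc)
    also have "\<dots> \<le> (\<Sum>y\<in>Y. ?A y)"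
      using yY nn finY by (intro member_le_sum) auto
    also have "\<dots> \<le> (\<Sum>y\<in>Y. ?A y) + (\<Sum>y\<in>Y. \<Sum>y'\<in>Y. ?B y y')"
      using nn(2) by (simp add: sum_nonneg)
    finally show ?thesis .
  next
    case 2
    have y': "y' \<in> Y" "adj E j y'" using 2 by (auto simp: nbrs_def)
    have na: "\<not> adj E i y'" "\<not> adj E y j"
      using 2 y y'(1) yY(1) adj_sym[of E j y] by (auto simp: nbrs_def)
    then have path: "path4 E y i j y'"
      using 2 yY y' adj_ij iV jV by (auto simp: path4_def adj_def)
    have "E i \<inter> E y' = {}" "E j \<inter> E y = {}"
      using na y' yY iV jV by (auto simp: adj_def)
    then have eq: "residual Y i \<union> residual Y j = E i \<union> E j - (E y \<union> E y')"
      unfolding residual_eq[OF iV] residual_eq[OF jV] y 2(1) by auto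
    have "p ^ card (residual Y i \<union> residual Y j) = ?B y y'" by (simp add: eq path)
    also have "\<dots> \<le> (\<Sum>y'\<in>Y. ?B y y')"
      using nn y' finY by (intro member_le_sum) auto
    also have "\<dots> \<le> (\<Sum>y\<in>Y. \<Sum>y'\<in>Y. ?B y y')"
      using nn(2) yY finY by (intro member_le_sum[of y Y "\<lambda>y. \<Sum>y'\<in>Y. ?B y y'"] sum_nonneg) auto
    also have "\<dots> \<le> (\<Sum>y\<in>Y. ?A y) + (\<Sum>y\<in>Y. \<Sum>y'\<in>Y. ?B y y')"
      using nn(1) by (simp add: sum_nonneg)
    finally show ?thesis .
  qed
qed

lemma residual_pairs_le:
  assumes Y: "Y \<subseteq> V"
  shows "(\<Sum>i\<in>touching Y. \<Sum>j\<in>nbrs (residual Y) (free Y \<union> touching Y) i. p ^ card (residual Y i \<union> residual Y j))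
    \<le> (\<Sum>y\<in>Y. T3 y / p ^ s) + Q4 X N E p Y"
proof -
  let ?A = "\<lambda>i j. \<Sum>y\<in>Y. of_bool (linked3 E y i j) * p ^ card (E y \<union> E i \<union> E j) / p ^ s"
  let ?B = "\<lambda>i j. \<Sum>y\<in>Y. \<Sum>y'\<in>Y. of_bool (path4 E y i j y') * p ^ card (E i \<union> E j - (E y \<union> E y'))"
  have nn: "0 \<le> ?A i j + ?B i j" for i j
    using p_bounds by (intro add_nonneg_nonneg sum_nonneg) auto
  have "(\<Sum>i\<in>touching Y. \<Sum>j\<in>nbrs (residual Y) (free Y \<union> touching Y) i. p ^ card (residual Y i \<union> residual Y j))
    \<le> (\<Sum>i\<in>touching Y. \<Sum>j\<in>nbrs (residual Y) (free Y \<union> touching Y) i. ?A i j + ?B i j)"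
    by (intro sum_mono residual_pair_le Y)
  also have "\<dots> \<le> (\<Sum>i\<in>touching Y. \<Sum>j\<in>V. ?A i j + ?B i j)"
    using nn by (intro sum_mono sum_mono2) (auto simp: nbrs_def free_def touching_def)
  also have "\<dots> \<le> (\<Sum>i\<in>V. \<Sum>j\<in>V. ?A i j + ?B i j)"
    using nn free_touching by (intro sum_mono2) (auto intro!: sum_nonneg)
  also have "\<dots> = (\<Sum>i\<in>V. \<Sum>j\<in>V. ?A i j) + (\<Sum>i\<in>V. \<Sum>j\<in>V. ?B i j)"
    by (simp only: sum.distrib)
  finally have le: "(\<Sum>i\<in>touching Y. \<Sum>j\<in>nbrs (residual Y) (free Y \<union> touching Y) i.
      p ^ card (residual Y i \<union> residual Y j)) \<le> (\<Sum>i\<in>V. \<Sum>j\<in>V. ?A i j) + (\<Sum>i\<in>V. \<Sum>j\<in>V. ?B i j)" .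
  have swap: "(\<Sum>i\<in>V. \<Sum>j\<in>V. \<Sum>y\<in>Y. f i j y) = (\<Sum>y\<in>Y. \<Sum>i\<in>V. \<Sum>j\<in>V. f i j y)"
    for f :: "nat \<Rightarrow> nat \<Rightarrow> nat \<Rightarrow> real"
    by (rule trans[OF sum.cong[OF refl sum.swap] sum.swap])
  have "(\<Sum>i\<in>V. \<Sum>j\<in>V. ?A i j) = (\<Sum>y\<in>Y. T3 y / p ^ s)"
    unfolding swap T3_def sum_divide_distrib ..
  moreover have "(\<Sum>i\<in>V. \<Sum>j\<in>V. ?B i j) = Q4 X N E p Y"
    unfolding swap Q4_eq[OF Y, symmetric] ..
  ultimately show ?thesis using le by linarith
qed

text \<open>The local form of the first-order comparison: equality for free and touching
  \<open>i\<close>, the \<phi> term for \<open>i\<close> in \<open>Y\<close>, and a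
  \<open>Q3\<close> term when \<open>i\<close> has at least two neighbours in
  \<open>Y\<close>.\<close>

lemma index_bound:
  assumes Y: "Y \<subseteq> V" and i: "i \<in> V"
  shows "p ^ s + (\<Sum>y\<in>nbrs E Y i. p ^ card (E i - E y) - p ^ s) \<le>
    of_bool (i \<in> free Y) * p ^ s + of_bool (i \<in> touching Y) * p ^ card (residual Y i) +
    of_bool (i \<in> Y) * (p ^ s + phi X N E p * card (nbrs E Y i)) +
    2 * (\<Sum>y\<in>Y. \<Sum>y'\<in>Y. of_bool (linked3 E y y' i) * p ^ card (E i - E y))"
    (is "?h \<le> ?a + ?b + ?c + 2 * ?d")
proof -
  have finY: "finite Y" using Y finite_subset by blast
  define J where "J = nbrs E Y i"
  have J: "finite J" "J \<subseteq> Y" using finY by (auto simp: J_def nbrs_def)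
  have J_adj: "adj E i y" "i \<noteq> y" "y \<in> V" if "y \<in> J" for y
    using that Y by (auto simp: J_def nbrs_def adj_def)
  let ?q = "\<lambda>y. p ^ card (E i - E y)"
  have nn: "0 \<le> ?a" "0 \<le> ?b" "0 \<le> ?c" "0 \<le> ?d"
    using p_bounds phi_nonneg by (auto intro!: sum_nonneg)
  have pi: "0 \<le> p ^ s" using p_bounds by simp
  have pi_le: "p ^ s \<le> ?q y" for y
    using i card_mono[of "E i" "E i - E y"] by (intro pow_antimono) (auto simp: finE card_E)
  show ?thesis
  proof (cases "i \<in> Y")
    case True
    have "(\<Sum>y\<in>J. ?q y - p ^ s) \<le> (\<Sum>y\<in>J. phi X N E p)"
    proof (rule sum_mono)
      fix y assume "y \<in> J"
      then have "?q y \<le> phi X N E p" using phi_ge[OF i] J_adj by blast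
      then show "?q y - p ^ s \<le> phi X N E p" using pi by linarith
    qed
    then have "?h \<le> ?c" using True by (simp add: J_def mult.commute)
    then show ?thesis using nn by linarith
  next
    case False
    consider "J = {}" | y where "J = {y}" | y y' where "y \<in> J" "y' \<in> J" "y \<noteq> y'"
      by blast
    then show ?thesis
    proof cases
      case 1
      then have "i \<in> free Y" using False i by (simp add: free_def J_def)
      then have "?h = ?a" using 1 by (simp add: J_def)
      then show ?thesis using nn by linarith
    next
      case (2 y)
      then have "i \<in> touching Y" using False i by (simp add: touching_def J_def)
      moreover have "residual Y i = E i - E y"
        using residual_eq[of i Y] 2 False i by (simp add: J_def)
      ultimately have "?h = ?b" using 2 by (simp add: J_def)
      then show ?thesis using nn by linarith
    next
      case (3 y y')
      have other: "?q z \<le> (\<Sum>z'\<in>Y. of_bool (linked3 E z z' i) * ?q z)" if z: "z \<in> J" for z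
      proof -
        \<comment> \<open>A second neighbour makes \<open>z, z', i\<close> a 3-cluster centred at
          \<open>i\<close>, so the term for \<open>z\<close> is charged to
          \<open>Q3\<close>.\<close>
        obtain z' where z': "z' \<in> J" "z' \<noteq> z" using 3 by metis
        have "linked3 E z z' i"
          using J_adj[OF z] J_adj[OF z'(1)] z' by (auto simp: linked3_def)
        then have "?q z = of_bool (linked3 E z z' i) * ?q z" by simp
        also have "\<dots> \<le> (\<Sum>z'\<in>Y. of_bool (linked3 E z z' i) * ?q z)"
          using z' J finY p_bounds by (intro member_le_sum) auto
        finally show ?thesis .
      qed
      have "(\<Sum>z\<in>J. ?q z) \<le> (\<Sum>z\<in>J. \<Sum>z'\<in>Y. of_bool (linked3 E z z' i) * ?q z)"
        by (intro sum_mono other)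
      also have "\<dots> \<le> ?d"
        using J finY p_bounds by (intro sum_mono2 sum_nonneg) auto
      finally have d: "(\<Sum>z\<in>J. ?q z) \<le> ?d" .
      have "p ^ s \<le> ?q y" by (rule pi_le)
      also have "\<dots> \<le> (\<Sum>z\<in>J. ?q z)"
        using 3 J p_bounds by (intro member_le_sum) auto
      finally have 1: "p ^ s \<le> ?d" using d by linarith
      have "(\<Sum>z\<in>J. ?q z - p ^ s) \<le> (\<Sum>z\<in>J. ?q z)"
        using pi by (intro sum_mono) auto
      \<comment> \<open>One \<open>?d\<close> pays for \<open>p ^ s\<close>, the other for the
        conditional probabilities.\<close>
      then have "?h \<le> 2 * ?d" using 1 d unfolding J_def by linarith
      then show ?thesis using nn by linarith
    qed
  qed
qed

text \<open>Summing \<open>index_bound\<close> over \<open>i\<close> and exchanging sums regroups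
  the corrections by \<open>y\<close>, where they become \<open>excess y / p ^ s\<close>. It bounds
  from below the total mass of the forbidden events in Janson's exponent.\<close>

lemma first_order:
  assumes Y: "Y \<subseteq> V"
  shows "p ^ s * real N + (\<Sum>y\<in>Y. excess y / p ^ s) \<le>
    (\<Sum>i\<in>free Y. p ^ s) + (\<Sum>i\<in>touching Y. p ^ card (residual Y i)) +
    p ^ s * real (card Y) + 2 * (phi X N E p * Q2 N E Y) + 2 * Q3 X N E p Y"
proof -
  have finY: "finite Y" using Y finite_subset by blast
  let ?d = "\<lambda>i. \<Sum>y\<in>Y. \<Sum>y'\<in>Y. of_bool (linked3 E y y' i) * p ^ card (E i - E y)"
  have "excess y / p ^ s = (\<Sum>i\<in>V. of_bool (adj E i y) * (p ^ card (E i - E y) - p ^ s))" if "y \<in> Y" for y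
  proof -
    have yV: "y \<in> V" using that Y by auto
    have "excess y / p ^ s = (\<Sum>i\<in>nbrs E V y. p ^ card (E i - E y) - p ^ s)"
      unfolding excess_def sum_divide_distrib
    proof (rule sum.cong[OF refl])
      fix i assume "i \<in> nbrs E V y"
      then have "i \<in> V" by (simp add: nbrs_def)
      then have "p ^ card (E y \<union> E i) = p ^ s * p ^ card (E i - E y)"
        using pow_Un_eq[of "E y" "E i"] yV by (simp add: finE card_E)
      then show "(p ^ card (E y \<union> E i) - p ^ s * p ^ s) / p ^ s = p ^ card (E i - E y) - p ^ s"
        using p_bounds by (simp add: field_simps)
    qed
    also have "\<dots> = (\<Sum>i\<in>V. of_bool (adj E i y) * (p ^ card (E i - E y) - p ^ s))"
      unfolding nbrs_def adj_sym[of E y] by (intro sum.mono_neutral_cong_left) auto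
    finally show ?thesis .
  qed
  then have "(\<Sum>y\<in>Y. excess y / p ^ s) = (\<Sum>y\<in>Y. \<Sum>i\<in>V. of_bool (adj E i y) * (p ^ card (E i - E y) - p ^ s))"
    by (rule sum.cong[OF refl])
  also have "\<dots> = (\<Sum>i\<in>V. \<Sum>y\<in>Y. of_bool (adj E i y) * (p ^ card (E i - E y) - p ^ s))"
    by (rule sum.swap)
  also have "\<dots> = (\<Sum>i\<in>V. \<Sum>y\<in>nbrs E Y i. p ^ card (E i - E y) - p ^ s)"
    unfolding nbrs_def using finY by (intro sum.cong[OF refl] sum.mono_neutral_cong_right) auto
  finally have "p ^ s * real N + (\<Sum>y\<in>Y. excess y / p ^ s) =
     (\<Sum>i\<in>V. p ^ s + (\<Sum>y\<in>nbrs E Y i. p ^ card (E i - E y) - p ^ s))"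
    by (simp add: sum.distrib)
  also have "\<dots> \<le> (\<Sum>i\<in>V. of_bool (i \<in> free Y) * p ^ s + of_bool (i \<in> touching Y) * p ^ card (residual Y i) +
    of_bool (i \<in> Y) * (p ^ s + phi X N E p * card (nbrs E Y i)) + 2 * ?d i)"
    by (intro sum_mono index_bound Y)
  also have "\<dots> = (\<Sum>i\<in>V. of_bool (i \<in> free Y) * p ^ s) +
      (\<Sum>i\<in>V. of_bool (i \<in> touching Y) * p ^ card (residual Y i)) +
      (\<Sum>i\<in>V. of_bool (i \<in> Y) * (p ^ s + phi X N E p * card (nbrs E Y i))) + 2 * (\<Sum>i\<in>V. ?d i)"
    by (simp only: sum.distrib sum_distrib_left)
  also have "(\<Sum>i\<in>V. of_bool (i \<in> free Y) * p ^ s) = (\<Sum>i\<in>free Y. p ^ s)"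
    using free_touching by (intro sum.mono_neutral_cong_right) auto
  also have "(\<Sum>i\<in>V. of_bool (i \<in> touching Y) * p ^ card (residual Y i)) = (\<Sum>i\<in>touching Y. p ^ card (residual Y i))"
    using free_touching by (intro sum.mono_neutral_cong_right) auto
  also have "(\<Sum>i\<in>V. of_bool (i \<in> Y) * (p ^ s + phi X N E p * card (nbrs E Y i))) =
      (\<Sum>i\<in>Y. p ^ s + phi X N E p * card (nbrs E Y i))"
    using Y by (intro sum.mono_neutral_cong_right) auto
  also have "\<dots> = p ^ s * real (card Y) + 2 * (phi X N E p * Q2 N E Y)"
    by (simp add: Q2_eq[OF Y] sum.distrib sum_distrib_left)
  also have "(\<Sum>i\<in>V. ?d i) = (\<Sum>y\<in>Y. \<Sum>y'\<in>Y. \<Sum>i\<in>V. of_bool (linked3 E y y' i) * p ^ card (E i - E y))"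
    by (rule trans[OF sum.swap sum.cong[OF refl sum.swap]])
  finally show ?thesis using Q3_ge[OF Y] by linarith
qed

end

text \<open>Rests on \<open>- ln (1 - x) \<le> x + x^2 / \<epsilon>\<close>, and on lowering the
  exponent from \<open>N\<close> to \<open>N - m\<close>, which only increases a power of
  \<open>1 - x\<close>.\<close>

lemma exp_le_one_minus_power:
  fixes x \<epsilon> :: real
  assumes "0 \<le> x" "0 < \<epsilon>" "\<epsilon> \<le> 1 - x"
  shows "exp (- (x * real N)) \<le> (1 - x) ^ (N - m) * exp (x\<^sup>2 * real N / \<epsilon>)"
proof -
  have pos: "0 < 1 - x" using assms by linarith
  have "- ln (1 - x) = ln (1 / (1 - x))" using pos by (simp add: ln_div)
  also have "\<dots> \<le> 1 / (1 - x) - 1" using pos by (intro ln_le_minus_one) simp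
  also have "\<dots> = x + x\<^sup>2 / (1 - x)" using pos by (simp add: field_simps power2_eq_square)
  also have "\<dots> \<le> x + x\<^sup>2 / \<epsilon>" using assms by (intro add_left_mono divide_left_mono) auto
  finally have "real N * (- x) \<le> real N * (ln (1 - x) + x\<^sup>2 / \<epsilon>)"
    by (intro mult_left_mono) auto
  then have "exp (- (x * real N)) \<le> exp (real N * ln (1 - x)) * exp (x\<^sup>2 * real N / \<epsilon>)"
    unfolding exp_add[symmetric] by (simp add: algebra_simps)
  also have "exp (real N * ln (1 - x)) = (1 - x) ^ N"
    using pos by (simp add: exp_of_nat_mult)
  also have "(1 - x) ^ N * exp (x\<^sup>2 * real N / \<epsilon>) \<le> (1 - x) ^ (N - m) * exp (x\<^sup>2 * real N / \<epsilon>)"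
    using pos assms by (intro mult_right_mono power_decreasing) auto
  finally show ?thesis .
qed

section \<open>Assembling the bound\<close>

context hypergraph_model
begin

lemma power_card_R: "p ^ card (R E Y) = (p ^ s) ^ card Y * p powi (- t E s Y)"
proof -
  have "(p ^ s) ^ card Y * p powi (- t E s Y) = p powi (int s * int (card Y)) * p powi (- t E s Y)"
    by (simp add: power_mult[symmetric] flip: of_nat_mult)
  also have "\<dots> = p powi int (card (R E Y))"
    using p_bounds by (simp add: power_int_add[symmetric] t_def)
  finally show ?thesis by simp
qed

lemma prob_eq_le_exp:
  assumes Y: "Y \<subseteq> V"
  shows "\<P>(W in random_subset X p. contained_edges N E W = Y) \<le> p ^ card (R E Y) *
    exp (- (p ^ s * real N) - (\<Sum>y\<in>Y. excess y / p ^ s) + (Delta X N E p 2 - Delta2_0 X N E p) +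
      p ^ s * real (card Y) + 2 * (phi X N E p * Q2 N E Y) + 2 * Q3 X N E p Y + Q4 X N E p Y +
      (\<Sum>y\<in>Y. T3 y / p ^ s) + 2 * (phi X N E p * Delta X N E p 2) + 12 * Delta X N E p 3)"
    (is "_ \<le> _ * exp ?L")
proof -
  define Z where "Z = free Y \<union> touching Y"
  let ?pairs = "\<Sum>i\<in>touching Y. \<Sum>j\<in>nbrs (residual Y) Z i. p ^ card (residual Y i \<union> residual Y j)"
  have "avoid X p (residual Y) Z \<le> avoid X p (residual Y) (free Y) *
      exp (- (\<Sum>i\<in>touching Y. p ^ card (residual Y i)) + ?pairs)"
    unfolding Z_def using free_touching[of Y]
    by (intro janson_extend finX p_bounds residual_sub) auto
  also have "\<dots> \<le> exp (- (\<Sum>i\<in>free Y. p ^ s) +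
     (Delta X N E p 2 - Delta2_0 X N E p) + (2 * (phi X N E p * Delta X N E p 2) + 12 * Delta X N E p 3)) *
      exp (- (\<Sum>i\<in>touching Y. p ^ card (residual Y i)) + ?pairs)"
    by (intro mult_right_mono avoid_free_le) auto
  also have "\<dots> \<le> exp ?L"
    unfolding exp_add[symmetric] exp_le_cancel_iff
    using first_order[OF Y] residual_pairs_le[OF Y] unfolding Z_def by linarith
  finally have "avoid X p (residual Y) Z \<le> exp ?L" .
  then have "p ^ card (R E Y) * avoid X p (residual Y) Z \<le> p ^ card (R E Y) * exp ?L"
    using p_bounds by (intro mult_left_mono) auto
  then show ?thesis
    using prob_eq_le[OF Y] unfolding Z_def by linarith
qed

text \<open>By symmetry \<open>excess y\<close> is the same for all \<open>y\<close>, which produces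
  \<open>2 |Y| / \<mu>\<close>. The \<open>T3\<close> sum is of order \<open>Delta3\<close> because
  \<open>|Y| \<le> C' \<mu>\<close>, and \<open>exp (- \<mu>)\<close> becomes a power of
  \<open>1 - \<pi>\<close> at the cost \<open>\<pi>^2 N / \<epsilon>\<close>.\<close>

lemma prob_bound:
  assumes sym: "symmetric_hypergraph X N E" and Y: "Y \<subseteq> V"
    and \<epsilon>: "0 < \<epsilon>" "\<epsilon> \<le> 1 - p ^ s"
    and C: "0 \<le> C" "phi X N E p * Delta X N E p 2 \<le> C * Delta X N E p 3"
    and C': "0 \<le> C'" "real (card Y) \<le> C' * (p ^ s * real N)"
  shows "\<P>(W in random_subset X p. contained_edges N E W = Y) \<le>
    (p ^ s) ^ card Y * (1 - p ^ s) ^ (N - card Y) * p powi (- t E s Y) *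
    exp (- ((2 * real (card Y) / (p ^ s * real N) - 1) * (Delta X N E p 2 - Delta2_0 X N E p)) +
      (15 + 2 * C + 7 * C' + 1 / \<epsilon>) * (Delta X N E p 3 + phi X N E p * Q2 N E Y + Q3 X N E p Y
                       + Q4 X N E p Y + (p ^ s)\<^sup>2 * real N))"
proof -
  define q where "q = p ^ s"
  define D where "D = Delta X N E p 2 - Delta2_0 X N E p"
  define D3 where "D3 = Delta X N E p 3"
  define A where "A = phi X N E p * Q2 N E Y"
  define B where "B = Q3 X N E p Y"
  define F where "F = Q4 X N E p Y"
  define G where "G = q\<^sup>2 * real N"
  have q: "0 < q" using p_pos by (simp add: q_def)
  have nn: "0 \<le> D3" "0 \<le> A" "0 \<le> B" "0 \<le> F" "0 \<le> G"
    using Delta_nonneg phi_nonneg Q_nonneg by (simp_all add: D3_def A_def B_def F_def G_def)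
  have Npos: "0 < real N" if "y \<in> Y" for y using that Y by auto
  have "excess y / q = 2 / (q * real N) * D" if "y \<in> Y" for y
  proof -
    have "real N * excess y = 2 * D"
      using symmetric_averages(2)[OF sym] that Y unfolding D_def by blast
    then show ?thesis using Npos[OF that] q by (simp add: field_simps)
  qed
  then have excess: "(\<Sum>y\<in>Y. excess y / q) = 2 * real (card Y) / (q * real N) * D"
    by simp
  have "(\<Sum>y\<in>Y. T3 y / q) \<le> (\<Sum>y\<in>Y. 6 * D3 / (q * real N))"
  proof (rule sum_mono)
    fix y assume y: "y \<in> Y"
    then have "real N * T3 y \<le> 6 * D3"
      using symmetric_averages(1)[OF sym] Y unfolding D3_def by blast
    then show "T3 y / q \<le> 6 * D3 / (q * real N)"
      using Npos[OF y] q by (simp add: field_simps)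
  qed
  also have "\<dots> = real (card Y) * (6 * D3 / (q * real N))" by simp
  also have "\<dots> \<le> C' * (q * real N) * (6 * D3 / (q * real N))"
    using C' nn q by (intro mult_right_mono) (auto simp: q_def)
  \<comment> \<open>For \<open>N = 0\<close> the left side is 0; otherwise \<open>q * real N\<close>
    cancels.\<close>
  also have "\<dots> \<le> 6 * C' * D3" using C' nn q by (cases "N = 0") auto
  finally have T3: "(\<Sum>y\<in>Y. T3 y / q) \<le> 6 * C' * D3" .
  have "q * real (card Y) \<le> q * (C' * (q * real N))"
    using C' q by (intro mult_left_mono) (auto simp: q_def)
  then have qY: "q * real (card Y) \<le> C' * G" by (simp add: G_def power2_eq_square mult_ac)
  \<comment> \<open>Chosen to dominate the coefficient of each of the five error terms.\<close>
  let ?K = "15 + 2 * C + 7 * C' + 1 / \<epsilon>"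
  let ?M = "2 * real (card Y) / (q * real N)"
  have "12 * D3 + 2 * C * D3 + 6 * C' * D3 + 2 * A + 2 * B + F + C' * G + G / \<epsilon> =
     (12 + 2 * C + 6 * C') * D3 + 2 * A + 2 * B + F + (C' + 1 / \<epsilon>) * G"
    by (simp add: algebra_simps)
  also have "\<dots> \<le> ?K * D3 + ?K * A + ?K * B + ?K * F + ?K * G"
  proof -
    have "0 \<le> 1 / \<epsilon>" using \<epsilon> by simp
    then have le: "12 + 2 * C + 6 * C' \<le> ?K" "2 \<le> ?K" "1 \<le> ?K" "C' + 1 / \<epsilon> \<le> ?K"
      using C C' by linarith+
    have "(12 + 2 * C + 6 * C') * D3 \<le> ?K * D3" "2 * A \<le> ?K * A" "2 * B \<le> ?K * B" "1 * F \<le> ?K * F"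
      "(C' + 1 / \<epsilon>) * G \<le> ?K * G"
      by (rule mult_right_mono; fact)+
    then show ?thesis by linarith
  qed
  also have "\<dots> = ?K * (D3 + A + B + F + G)" by (simp only: distrib_left)
  finally have K: "12 * D3 + 2 * C * D3 + 6 * C' * D3 + 2 * A + 2 * B + F + C' * G + G / \<epsilon> \<le> ?K * (D3 + A + B + F + G)" .
  have "\<P>(W in random_subset X p. contained_edges N E W = Y) \<le> p ^ card (R E Y) *
    exp (- (q * real N) - ?M * D + D + q * real (card Y) + 2 * A + 2 * B + F +
      (\<Sum>y\<in>Y. T3 y / q) + 2 * (phi X N E p * Delta X N E p 2) + 12 * D3)"
    using prob_eq_le_exp[OF Y] unfolding excess[unfolded q_def D_def] q_def D_def D3_def A_def B_def F_def .
  \<comment> \<open>The reserve \<open>- G / \<epsilon>\<close> cancels the factor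
    \<open>exp (G / \<epsilon>)\<close> that arises when \<open>exp (- (q * real N))\<close> is
    replaced by a power of \<open>1 - q\<close>.\<close>
  also have "\<dots> \<le> p ^ card (R E Y) * exp (- (q * real N) + (- ((?M - 1) * D) + ?K * (D3 + A + B + F + G) - G / \<epsilon>))"
  proof (intro mult_left_mono, unfold exp_le_cancel_iff)
    have "- ((?M - 1) * D) = - ?M * D + D" by (simp add: algebra_simps)
    then show "- (q * real N) - ?M * D + D + q * real (card Y) + 2 * A + 2 * B + F +
      (\<Sum>y\<in>Y. T3 y / q) + 2 * (phi X N E p * Delta X N E p 2) + 12 * D3 \<le>
      - (q * real N) + (- ((?M - 1) * D) + ?K * (D3 + A + B + F + G) - G / \<epsilon>)"
      using K T3 qY C(2) unfolding D3_def[symmetric] by linarith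
  qed (use p_bounds in auto)
  also have "\<dots> = p ^ card (R E Y) * (exp (- (q * real N)) * exp (- ((?M - 1) * D) + ?K * (D3 + A + B + F + G) - G / \<epsilon>))"
    by (simp only: exp_add)
  also have "\<dots> \<le> p ^ card (R E Y) * (((1 - q) ^ (N - card Y) * exp (G / \<epsilon>)) *
      exp (- ((?M - 1) * D) + ?K * (D3 + A + B + F + G) - G / \<epsilon>))"
    unfolding G_def using q \<epsilon> p_bounds
    by (intro mult_left_mono mult_right_mono exp_le_one_minus_power) (auto simp: q_def)
  also have "\<dots> = p ^ card (R E Y) * (1 - q) ^ (N - card Y) *
      exp (- ((?M - 1) * D) + ?K * (D3 + A + B + F + G))"
    by (simp add: exp_diff)
  also have "\<dots> = q ^ card Y * (1 - q) ^ (N - card Y) * p powi (- t E s Y) *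
      exp (- ((?M - 1) * D) + ?K * (D3 + A + B + F + G))"
    unfolding power_card_R q_def by (simp only: mult_ac)
  finally show ?thesis
    unfolding q_def D_def D3_def A_def B_def F_def G_def .
qed

lemma error_terms_nonneg:
  "0 \<le> Delta X N E p 3 + phi X N E p * Q2 N E Y + Q3 X N E p Y + Q4 X N E p Y + (p ^ s)\<^sup>2 * real N"
  using Delta_nonneg phi_nonneg Q_nonneg by (intro add_nonneg_nonneg mult_nonneg_nonneg) auto

end

theorem theorem4p1:
  fixes \<epsilon> C C' :: real
  assumes "\<epsilon> > 0"
  shows "\<exists>K::real. \<forall>(X :: 'a set) (N :: nat) (E :: nat \<Rightarrow> 'a set) (s :: nat) (p :: real).
    uniform_hypergraph X N E s \<longrightarrow>
    symmetric_hypergraph X N E \<longrightarrow>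
    0 < p \<longrightarrow> p < 1 \<longrightarrow>
    (let \<pi> = p ^ s; \<mu> = \<pi> * real N in
      1 - \<pi> \<ge> \<epsilon> \<longrightarrow>
      phi X N E p * Delta X N E p 2 \<le> C * Delta X N E p 3 \<longrightarrow>
      (\<exists>\<eta> :: nat set \<Rightarrow> real. \<forall>Y \<subseteq> {1..N}. real (card Y) \<le> C' * \<mu> \<longrightarrow>
        \<bar>\<eta> Y\<bar> \<le> K * (Delta X N E p 3 + phi X N E p * Q2 N E Y + Q3 X N E p Y
                       + Q4 X N E p Y + \<pi>\<^sup>2 * real N) \<and>
        \<P>(W in random_subset X p. contained_edges N E W = Y)
          \<le> \<pi> ^ card Y * (1 - \<pi>) ^ (N - card Y) * p powi (- t E s Y)
            * exp (- ((2 * real (card Y) / \<mu> - 1) * (Delta X N E p 2 - Delta2_0 X N E p))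
                   + \<eta> Y)))"
proof -
  \<comment> \<open>The given \<open>C\<close> and \<open>C'\<close> may be negative, whereas
    \<open>prob_bound\<close> expects nonnegative constants.\<close>
  define K where "K = 15 + 2 * \<bar>C\<bar> + 7 * \<bar>C'\<bar> + 1 / \<epsilon>"
  have K: "0 \<le> K" using assms by (simp add: K_def)
  show ?thesis
  proof (rule exI[of _ K], intro allI impI, unfold Let_def, intro impI)
    fix X :: "'a set" and N E s and p :: real
    assume *: "uniform_hypergraph X N E s" "symmetric_hypergraph X N E" "0 < p" "p < 1"
      "1 - p ^ s \<ge> \<epsilon>" and **: "phi X N E p * Delta X N E p 2 \<le> C * Delta X N E p 3"
    interpret hypergraph_model X N E s p using * by unfold_locales
    let ?Q = "\<lambda>Y. Delta X N E p 3 + phi X N E p * Q2 N E Y + Q3 X N E p Y + Q4 X N E p Y + (p ^ s)\<^sup>2 * real N"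
    have "C * Delta X N E p 3 \<le> \<bar>C\<bar> * Delta X N E p 3"
      by (intro mult_right_mono Delta_nonneg) simp
    with ** have C: "phi X N E p * Delta X N E p 2 \<le> \<bar>C\<bar> * Delta X N E p 3" by linarith
    show "\<exists>\<eta> :: nat set \<Rightarrow> real. \<forall>Y \<subseteq> {1..N}. real (card Y) \<le> C' * (p ^ s * real N) \<longrightarrow>
        \<bar>\<eta> Y\<bar> \<le> K * ?Q Y \<and>
        \<P>(W in random_subset X p. contained_edges N E W = Y)
          \<le> (p ^ s) ^ card Y * (1 - p ^ s) ^ (N - card Y) * p powi (- t E s Y)
            * exp (- ((2 * real (card Y) / (p ^ s * real N) - 1) * (Delta X N E p 2 - Delta2_0 X N E p))
                   + \<eta> Y)"
    \<comment> \<open>As only an upper bound is claimed, \<eta> can be the largest value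
      allowed.\<close>
    proof (rule exI[of _ "\<lambda>Y. K * ?Q Y"], intro allI impI conjI)
      fix Y assume Y: "Y \<subseteq> {1..N}" and cardY: "real (card Y) \<le> C' * (p ^ s * real N)"
      have "0 \<le> K * ?Q Y" by (rule mult_nonneg_nonneg[OF K error_terms_nonneg])
      then show "\<bar>K * ?Q Y\<bar> \<le> K * ?Q Y" by simp
      have "C' * (p ^ s * real N) \<le> \<bar>C'\<bar> * (p ^ s * real N)"
        using p_bounds by (intro mult_right_mono) auto
      with cardY have C': "real (card Y) \<le> \<bar>C'\<bar> * (p ^ s * real N)" by linarith
      show "\<P>(W in random_subset X p. contained_edges N E W = Y)
          \<le> (p ^ s) ^ card Y * (1 - p ^ s) ^ (N - card Y) * p powi (- t E s Y)
            * exp (- ((2 * real (card Y) / (p ^ s * real N) - 1) * (Delta X N E p 2 - Delta2_0 X N E p))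
                   + K * ?Q Y)"
        unfolding K_def
        by (rule prob_bound[OF *(2) Y assms *(5) abs_ge_zero C abs_ge_zero C'])
    qed
  qed
qed

end
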